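(* Assume (UM) (see context) and let the initial function $w_0$ satisfy (IC1). Let $c>c_\#$, $\lambda\in(\lambda_1(c),\lambda_2(c))$, set $\xi(x,\lambda)=e^{\lambda x}$, let $\phi=\phi_c$ be the profile of the semi-wavefront with speed $c$, and let $u(t,x)$ be the solution of $u_t=u_{xx}-u+g(u(t-h,x))$ ($t>0,\ x\in\mathbb{R}$), $u(s,x)=w_0(s,x)$ for $(s,x)\in[-h,0]\times\mathbb{R}$. A. If $\sup_{s\in[-h,0]}|\phi(\cdot+cs)-w_0(s,\cdot)|_\lambda<\infty$, then there are positive $C,\gamma$ such that $$\sup_{x\in\mathbb{R}}\frac{|u(t,x)-\phi(x+ct)|}{\xi(x+ct,\lambda)}\le Ce^{-\gamma t},\qquad t\ge0.$$ B. Let, in addition, $|g'(u)|<1$ on some interval $[\kappa-\rho,\kappa+\rho]$, $\rho>0$. If, for some $b\ge0$, $$\kappa-\rho/4\le w_0(s,x),\ \phi(x+cs)<\kappa+\rho/4\quad\text{for all } x\ge b-ch,\ s\in[-h,0],$$ $$|w_0(s,x)-\phi(x+cs)|\le 0.5\,\rho\, e^{\lambda(x+cs-b)},\quad x\le b,\ s\in[-h,0],$$ then $\phi$ is actually a wavefront profile (i.e. $\phi(+\infty)=\kappa$) and $$\sup_{x\in\mathbb{R}}\frac{|u(t,x)-\phi(x+ct)|}{\eta_\lambda(x+ct)}\le0.5\,\rho\, e^{-\gamma t},\qquad t\ge0,$$ for some $\gamma>0$.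
   Context: $h>0$ is a fixed delay. Hypothesis (H): $g:\mathbb{R}_+\to\mathbb{R}_+$ is continuous; $g(x)=x$ has exactly two nonnegative solutions, $0$ and $\kappa>0$; $g$ is $C^1$ in some $\delta_0$-neighbourhood of $0,\kappa$, with $g'(0)>1$, $g'(\kappa)<1$; $|g(u)-g(v)|\le L_g|u-v|$ for all $u,v\ge0$; and there are $C>0$, $\theta\in(0,1]$ with $|g'(u)-g'(0)|\le Cu^\theta$ for $u\in(0,\delta_0]$. ($g$ is extended linearly and $C^1$-smoothly to $(-\infty,0]$.) Hypothesis (UM): (H) holds, $L_g=g'(0)$ and $g$ is bounded. ($g$ need not be monotone.) Initial functions: $w_0:[-h,0]\times\mathbb{R}\to\mathbb{R}_+$ is continuous and locally H\"older continuous in $x$ uniformly with respect to $s\in[-h,0]$. (IC1): $0\le w_0(s,x)\le\sup w_0<\infty$. Solution: the unique classical solution, continuous on $[-h,\infty)\times\mathbb{R}$, bounded on finite time intervals, with continuous $u_t,u_x,u_{xx}$ for $t>0$. A semi-wavefront with speed $c$ is a solution $u(t,x)=\phi(x+ct)$ with $\phi$ positive, bounded, smooth, $\phi(-\infty)=0$ and $\liminf_{x\to+\infty}\phi(x)>0$; it is a wavefront if moreover $\phi(+\infty)=\kappa$. Let $\chi_0(\lambda)=\lambda^2-c\lambda-1+g'(0)e^{-\lambda ch}$; $c_\#$ is the unique value of $c$ for which $\chi_0$ has a double positive zero, and for $c\ge c_\#$, $\lambda_1(c)\le\lambda_2(c)$ are the two real zeros of $\chi_0$ (counting multiplicity), both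 positive. Under (UM), for each $c\ge c_\#$ there is a semi-wavefront with speed $c$, unique up to translation (known). For $\lambda\ge0$: $\eta_\lambda(t)=\min\{e^{\lambda t},1\}$ and $|f|_\lambda=\sup_{t\in\mathbb{R}}|f(t)|/\eta_\lambda(t)$. *)

theory Defs
  imports "HOL-Analysis.Analysis"
begin

section \<open>The nonlinearity\<close>

definition C1_on :: "(real \<Rightarrow> real) \<Rightarrow> real set \<Rightarrow> bool" where
  "C1_on g S \<longleftrightarrow> (\<forall>x\<in>S. g differentiable (at x)) \<and> continuous_on S (deriv g)"

text \<open>
  The nonlinearity is a total function on the reals.  The restriction to the nonnegative
  half-line carries all the hypotheses; the clause on \<open>x \<le> 0\<close> fixes the linear \<open>C\<^sup>1\<close>-extension to
  the negative half-line, so that \<open>deriv g 0\<close> is the right derivative of \<open>g\<close> at \<open>0\<close>.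
  The parameter \<open>L\<close> is the Lipschitz constant.
\<close>

definition hyp_H :: "(real \<Rightarrow> real) \<Rightarrow> real \<Rightarrow> real \<Rightarrow> bool" where
  "hyp_H g \<kappa> L \<longleftrightarrow>
     continuous_on {0..} g \<and> (\<forall>x\<ge>0. g x \<ge> 0) \<and>
     (\<forall>x\<le>0. g x = deriv g 0 * x) \<and>
     \<kappa> > 0 \<and> {x. x \<ge> 0 \<and> g x = x} = {0, \<kappa>} \<and>
     deriv g 0 > 1 \<and> deriv g \<kappa> < 1 \<and>
     (\<forall>u\<ge>0. \<forall>v\<ge>0. \<bar>g u - g v\<bar> \<le> L * \<bar>u - v\<bar>) \<and>
     (\<exists>\<delta>\<^sub>0>0. C1_on g {-\<delta>\<^sub>0..\<delta>\<^sub>0} \<and> C1_on g {\<kappa>-\<delta>\<^sub>0..\<kappa>+\<delta>\<^sub>0} \<and>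
        (\<exists>C>0. \<exists>\<theta>. 0 < \<theta> \<and> \<theta> \<le> 1 \<and>
           (\<forall>u. 0 < u \<and> u \<le> \<delta>\<^sub>0 \<longrightarrow> \<bar>deriv g u - deriv g 0\<bar> \<le> C * u powr \<theta>)))"

text \<open>Boundedness refers to the nonnegative half-line: the linear extension is unbounded.\<close>

definition hyp_UM :: "(real \<Rightarrow> real) \<Rightarrow> real \<Rightarrow> bool" where
  "hyp_UM g \<kappa> \<longleftrightarrow> hyp_H g \<kappa> (deriv g 0) \<and> bounded (g ` {0..})"

section \<open>Classical solutions\<close>

definition classical_on :: "real set \<Rightarrow> (real \<Rightarrow> real) \<Rightarrow> real \<Rightarrow> (real \<Rightarrow> real \<Rightarrow> real) \<Rightarrow> bool" where
  "classical_on T g h u \<longleftrightarrow>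
     (\<exists>ut ux uxx.
        continuous_on (T \<times> UNIV) (\<lambda>(t, x). ut t x) \<and>
        continuous_on (T \<times> UNIV) (\<lambda>(t, x). ux t x) \<and>
        continuous_on (T \<times> UNIV) (\<lambda>(t, x). uxx t x) \<and>
        (\<forall>t\<in>T. \<forall>x.
           ((\<lambda>\<tau>. u \<tau> x) has_real_derivative ut t x) (at t) \<and>
           ((\<lambda>y. u t y) has_real_derivative ux t x) (at x) \<and>
           ((\<lambda>y. ux t y) has_real_derivative uxx t x) (at x) \<and>
           ut t x = uxx t x - u t x + g (u (t - h) x)))"

definition is_solution ::
    "(real \<Rightarrow> real) \<Rightarrow> real \<Rightarrow> (real \<Rightarrow> real \<Rightarrow> real) \<Rightarrow> (real \<Rightarrow> real \<Rightarrow> real) \<Rightarrow> bool" where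
  "is_solution g h w\<^sub>0 u \<longleftrightarrow>
     continuous_on ({-h..} \<times> UNIV) (\<lambda>(t, x). u t x) \<and>
     (\<forall>T. bounded ((\<lambda>(t, x). u t x) ` ({-h..T} \<times> UNIV))) \<and>
     classical_on {0<..} g h u \<and>
     (\<forall>s\<in>{-h..0}. \<forall>x. u s x = w\<^sub>0 s x)"

definition initial_function :: "real \<Rightarrow> (real \<Rightarrow> real \<Rightarrow> real) \<Rightarrow> bool" where
  "initial_function h w\<^sub>0 \<longleftrightarrow>
     continuous_on ({-h..0} \<times> UNIV) (\<lambda>(s, x). w\<^sub>0 s x) \<and>
     (\<forall>s\<in>{-h..0}. \<forall>x. w\<^sub>0 s x \<ge> 0) \<and>
     (\<forall>K. compact K \<longrightarrow>
        (\<exists>\<alpha> M. 0 < \<alpha> \<and> \<alpha> \<le> 1 \<and>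
           (\<forall>s\<in>{-h..0}. \<forall>x\<in>K. \<forall>y\<in>K. \<bar>w\<^sub>0 s x - w\<^sub>0 s y\<bar> \<le> M * \<bar>x - y\<bar> powr \<alpha>)))"

definition IC1 :: "real \<Rightarrow> (real \<Rightarrow> real \<Rightarrow> real) \<Rightarrow> bool" where
  "IC1 h w\<^sub>0 \<longleftrightarrow>
     (\<forall>s\<in>{-h..0}. \<forall>x. 0 \<le> w\<^sub>0 s x) \<and> bdd_above ((\<lambda>(s, x). w\<^sub>0 s x) ` ({-h..0} \<times> UNIV))"

section \<open>Semi-wavefronts\<close>

text \<open>
  Since \<open>g\<close> is in general only Lipschitz continuous, smoothness of the profile means
  the regularity of a classical solution, which is part of \<open>classical_on\<close>.
\<close>

definition semi_wavefront :: "(real \<Rightarrow> real) \<Rightarrow> real \<Rightarrow> real \<Rightarrow> (real \<Rightarrow> real) \<Rightarrow> bool" where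
  "semi_wavefront g h c \<phi> \<longleftrightarrow>
     classical_on UNIV g h (\<lambda>t x. \<phi> (x + c * t)) \<and>
     (\<forall>y. \<phi> y > 0) \<and> bounded (range \<phi>) \<and>
     (\<phi> \<longlongrightarrow> 0) at_bot \<and> Liminf at_top (\<lambda>y. ereal (\<phi> y)) > 0"

definition wavefront :: "(real \<Rightarrow> real) \<Rightarrow> real \<Rightarrow> real \<Rightarrow> real \<Rightarrow> (real \<Rightarrow> real) \<Rightarrow> bool" where
  "wavefront g h \<kappa> c \<phi> \<longleftrightarrow> semi_wavefront g h c \<phi> \<and> (\<phi> \<longlongrightarrow> \<kappa>) at_top"

section \<open>The characteristic function at zero\<close>

definition chi0 :: "(real \<Rightarrow> real) \<Rightarrow> real \<Rightarrow> real \<Rightarrow> real \<Rightarrow> real" where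
  "chi0 g h c z = z\<^sup>2 - c * z - 1 + deriv g 0 * exp (- z * c * h)"

definition double_zero :: "(real \<Rightarrow> real) \<Rightarrow> real \<Rightarrow> bool" where
  "double_zero f z \<longleftrightarrow> f z = 0 \<and> deriv f z = 0 \<and> (deriv ^^ 2) f z \<noteq> 0"

definition c_sharp :: "(real \<Rightarrow> real) \<Rightarrow> real \<Rightarrow> real" where
  "c_sharp g h = (THE c. \<exists>z>0. double_zero (chi0 g h c) z)"

text \<open>
  For \<open>c \<ge> c_sharp g h\<close> the function \<open>chi0 g h c\<close> is strictly convex and has exactly two real
  zeros counted with multiplicity, hence a least and a greatest one.
\<close>

definition lambda1 :: "(real \<Rightarrow> real) \<Rightarrow> real \<Rightarrow> real \<Rightarrow> real" where
  "lambda1 g h c = (LEAST z. chi0 g h c z = 0)"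

definition lambda2 :: "(real \<Rightarrow> real) \<Rightarrow> real \<Rightarrow> real \<Rightarrow> real" where
  "lambda2 g h c = (GREATEST z. chi0 g h c z = 0)"

section \<open>Weights\<close>

definition xi :: "real \<Rightarrow> real \<Rightarrow> real" where
  "xi x l = exp (l * x)"

definition eta :: "real \<Rightarrow> real \<Rightarrow> real" where
  "eta l t = min (exp (l * t)) 1"

text \<open>Extended-real valued, so that finiteness of the norm is a genuine condition.\<close>

definition wnorm :: "real \<Rightarrow> (real \<Rightarrow> real) \<Rightarrow> ereal" where
  "wnorm l f = (SUP t. ereal (\<bar>f t\<bar> / eta l t))"

end

theory Submission
  imports Defs
begin

text \<open>
  Let \<open>w(t,x) = u(t,x) - \<phi>(x + ct)\<close> and \<open>z = x + ct\<close>.  Subtracting the two equations gives a linear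
  heat equation with absorption, \<open>w\<^sub>t = w\<^sub>x\<^sub>x - w + f\<close>, whose source
  \<open>f = g(u(t-h,x)) - g(\<phi>(z-ch))\<close> is controlled by the past of \<open>w\<close>: always
  \<open>\<bar>f\<bar> \<le> g'(0) \<bar>w(t-h,x)\<bar>\<close>, and with a better factor where both states are close to \<open>\<kappa>\<close>.
  Both parts of the theorem are therefore comparisons of \<open>\<plusminus>w\<close> with a positive function
  \<open>K exp(-\<gamma> t) m(z)\<close>, carried out on the time intervals \<open>[0, nh]\<close> by induction on \<open>n\<close>
  (\<open>delayed_comparison\<close>, \<open>stability_by_supersolution\<close>).

  For the exponential weight, \<open>m(z) = exp(l z)\<close>.  At \<open>\<gamma> = 0\<close> the supersolution inequality for this
  \<open>m\<close> says \<open>chi0(l) \<le> 0\<close>.  Since \<open>chi0\<close> is convex, positive at \<open>0\<close>, and takes a negative value for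
  \<open>c > c_sharp\<close>, it is strictly negative between its two zeros, which leaves room for a small
  positive \<open>\<gamma>\<close> (\<open>chi0_neg_between_lambda\<close>, \<open>global_stability_exponential_weight\<close>).

  For the bounded weight, the natural candidate is \<open>m(z) = min (exp(l(z-b))) 1\<close>: the exponential
  branch works as before, the constant branch needs the slopes of \<open>g\<close> near \<open>\<kappa>\<close> to be bounded by
  some \<open>q < 1\<close>.  Slopes that are merely less than \<open>1\<close> at each point, without continuity of \<open>g'\<close> on the
  whole interval, do not give such a \<open>q\<close>.  Two facts make up for this.  Since \<open>g\<close> is \<open>C\<^sup>1\<close> near
  \<open>\<kappa>\<close>, a uniform \<open>q < 1\<close> does exist as soon as one of the two compared states is close to \<open>\<kappa>\<close>
  (\<open>contraction_near_kappa\<close>).  It forces \<open>\<phi>(+\<infinity>) = \<kappa>\<close> (\<open>profile_tendsto_equilibrium\<close>), and hence it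
  is available for all large \<open>z\<close>.  On the remaining bounded range of \<open>z\<close>, \<open>g\<close> is nonexpansive and the
  constant \<open>1\<close> is replaced by a slowly increasing function \<open>ramp\<close> with values in \<open>[1 - \<epsilon>, 1]\<close>; its drift
  term supplies the missing dissipation.  There is room for \<open>\<epsilon> > 0\<close> under the sharp
  constant \<open>\<rho>/2\<close>, because the strict inequalities assumed of the initial data hold with a uniform
  gap (\<open>strict_initial_gap\<close>).
\<close>

section \<open>The characteristic function\<close>

lemma chi0_has_derivative:
  "(chi0 g h c has_real_derivative 2 * z - c - deriv g 0 * (c * h) * exp (- z * c * h)) (at z)"
  unfolding chi0_def by (auto intro!: derivative_eq_intros)

lemma deriv_chi0:
  "deriv (chi0 g h c) = (\<lambda>z. 2 * z - c - deriv g 0 * (c * h) * exp (- z * c * h))"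
  by (rule ext, rule DERIV_imp_deriv, rule chi0_has_derivative)

lemma deriv_chi0_has_derivative:
  "(deriv (chi0 g h c) has_real_derivative 2 + deriv g 0 * (c * h)\<^sup>2 * exp (- z * c * h)) (at z)"
  unfolding deriv_chi0 by (auto intro!: derivative_eq_intros simp: power2_eq_square)

lemma convex_on_chi0:
  assumes "deriv g 0 > 0"
  shows "convex_on UNIV (chi0 g h c)"
proof (rule f''_ge0_imp_convex)
  show "(chi0 g h c has_real_derivative deriv (chi0 g h c) z) (at z)" for z
    unfolding deriv_chi0 by (rule chi0_has_derivative)
  show "(deriv (chi0 g h c) has_real_derivative 2 + deriv g 0 * (c * h)\<^sup>2 * exp (- z * c * h)) (at z)"
    for z by (rule deriv_chi0_has_derivative)
qed (use assms in auto)

lemma chi0_above_tangent: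
  assumes "deriv g 0 > 0"
  shows "chi0 g h c z \<ge> chi0 g h c y + deriv (chi0 g h c) y * (z - y)"
proof -
  have "(chi0 g h c has_real_derivative deriv (chi0 g h c) y) (at y within UNIV)"
    unfolding deriv_chi0 using chi0_has_derivative by blast
  from convex_on_imp_above_tangent[OF convex_on_chi0[OF assms] _ _ _ this, of z]
  show ?thesis by (simp add: algebra_simps)
qed

lemma double_zero_chi0_iff:
  assumes "deriv g 0 > 0"
  shows "double_zero (chi0 g h c) z \<longleftrightarrow> chi0 g h c z = 0 \<and> deriv (chi0 g h c) z = 0"
proof -
  have "(deriv ^^ 2) (chi0 g h c) z = 2 + deriv g 0 * (c * h)\<^sup>2 * exp (- z * c * h)"
    using DERIV_imp_deriv[OF deriv_chi0_has_derivative] by (simp add: numeral_2_eq_2)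
  moreover have "deriv g 0 * (c * h)\<^sup>2 * exp (- z * c * h) \<ge> 0" using assms by simp
  ultimately show ?thesis unfolding double_zero_def by auto
qed

text \<open>
  Raising the speed pushes \<open>chi0\<close> down at every positive point.  This monotonicity makes the
  critical speed unique and gives \<open>chi0\<close> a negative value at every larger speed.
\<close>

lemma chi0_strict_antimono_speed:
  assumes "deriv g 0 > 0" "h > 0" "z > 0" "c < c'"
  shows "chi0 g h c' z < chi0 g h c z"
proof -
  have "- z * c' * h \<le> - z * c * h" using assms by (simp add: mult_right_mono)
  then have "deriv g 0 * exp (- z * c' * h) \<le> deriv g 0 * exp (- z * c * h)"
    using assms by simp
  moreover have "c * z < c' * z" using assms by simp
  ultimately show ?thesis unfolding chi0_def by linarith
qed

lemma chi0_pos_of_nonpos_speed: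
  assumes "deriv g 0 > 1" "h > 0" "z \<ge> 0" "c \<le> 0"
  shows "chi0 g h c z > 0"
proof -
  have "- z * c * h \<ge> 0" using assms by (simp add: mult_nonneg_nonpos mult_nonpos_nonneg)
  then have "deriv g 0 * exp (- z * c * h) \<ge> deriv g 0 * 1" using assms by (intro mult_left_mono) auto
  moreover have "c * z \<le> 0" using assms by (simp add: mult_nonpos_nonneg)
  ultimately show ?thesis unfolding chi0_def using assms zero_le_power2[of z] by linarith
qed

lemma chi0_pos_at_large:
  assumes "deriv g 0 > 0" "c \<ge> 0" "z \<ge> c + 1"
  shows "chi0 g h c z > 0"
proof -
  have "z * (z - c) \<ge> 1 * 1" using assms by (intro mult_mono) auto
  moreover have "deriv g 0 * exp (- z * c * h) > 0" using assms by simp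
  ultimately show ?thesis unfolding chi0_def by (simp add: power2_eq_square algebra_simps)
qed

lemma chi0_zero_pos: "deriv g 0 > 1 \<Longrightarrow> chi0 g h c 0 > 0"
  by (simp add: chi0_def)

text \<open>
  The critical speed is the least \<open>c \<ge> 0\<close> for which \<open>chi0\<close> is nonpositive somewhere on the half-line.
  It exists by compactness: \<open>chi0\<close> is positive beyond \<open>c + 1\<close>, so only a bounded set of pairs
  \<open>(c, z)\<close> matters.  At the least speed \<open>chi0\<close> cannot be negative anywhere, since a slightly smaller
  speed would then do; so its zero is a minimum, hence double.
\<close>

lemma ex_double_zero:
  assumes "deriv g 0 > 1" "h > 0"
  shows "\<exists>c. \<exists>z>0. double_zero (chi0 g h c) z"
proof -
  define p where "p = deriv g 0"
  have p: "p > 1" using assms p_def by simp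
  define K where "K = ({0..p} \<times> {0..p+1}) \<inter> {cz. chi0 g h (fst cz) (snd cz) \<le> 0}"
  have "closed {cz. chi0 g h (fst cz) (snd cz) \<le> 0}"
    unfolding chi0_def by (intro closed_Collect_le continuous_intros)
  then have "compact K" unfolding K_def by (intro compact_Int_closed compact_Times) auto
  \<comment> \<open>The speed \<open>g'(0)\<close> is admissible, since \<open>chi0\<close> is already nonpositive at \<open>1\<close> for it.\<close>
  moreover have "(p, 1) \<in> K"
  proof -
    have "p * exp (- (p * h)) \<le> p * 1" using p assms by (intro mult_left_mono) auto
    then show ?thesis using p by (simp add: K_def chi0_def p_def)
  qed
  ultimately obtain k where k: "k \<in> K" "\<And>k'. k' \<in> K \<Longrightarrow> fst k \<le> fst k'"
    using continuous_attains_inf[of K fst] continuous_on_fst[OF continuous_on_id] by blast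
  obtain c z where cz: "k = (c, z)" by (cases k)
  have c: "0 \<le> c" "c \<le> p" and z: "0 \<le> z" and le: "chi0 g h c z \<le> 0"
    using k(1) by (auto simp: K_def cz)
  have cpos: "c > 0"
    using chi0_pos_of_nonpos_speed[of g h z c] assms z le by (cases "c \<le> 0") auto
  have zpos: "z > 0"
    using chi0_zero_pos[OF assms(1), of h c] z le by (cases "z = 0") auto
  have nonneg: "chi0 g h c y \<ge> 0" if "y \<ge> 0" for y
  proof (rule ccontr)
    assume "\<not> ?thesis"
    then have neg: "chi0 g h c y < 0" by simp
    have "((\<lambda>c'. chi0 g h c' y) \<longlongrightarrow> chi0 g h c y) (at_left c)"
      unfolding chi0_def by (intro tendsto_intros)
    then have "eventually (\<lambda>c'. chi0 g h c' y < 0) (at_left c)"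
      using neg by (rule order_tendstoD(2))
    moreover have "eventually (\<lambda>c'. c' \<in> {0<..<c}) (at_left c)"
      using cpos eventually_at_left_real by blast
    ultimately have "eventually (\<lambda>c'. chi0 g h c' y < 0 \<and> c' \<in> {0<..<c}) (at_left c)"
      by (rule eventually_conj)
    then obtain c' where c': "chi0 g h c' y < 0" "0 < c'" "c' < c"
      using eventually_happens by fastforce
    have "y < c' + 1"
      using chi0_pos_at_large[of g c' y h] assms c' by (cases "y \<ge> c' + 1") auto
    then have "(c', y) \<in> K" using c' c that by (auto simp: K_def)
    then show False using k(2) c' cz by fastforce
  qed
  have zero: "chi0 g h c z = 0" using le nonneg[OF z] by simp
  have "deriv (chi0 g h c) z = 0"
  proof (rule DERIV_local_min)
    show "(chi0 g h c has_real_derivative deriv (chi0 g h c) z) (at z)"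
      unfolding deriv_chi0 by (rule chi0_has_derivative)
    show "0 < z" by (rule zpos)
    show "\<forall>y. \<bar>z - y\<bar> < z \<longrightarrow> chi0 g h c z \<le> chi0 g h c y" using zero nonneg by auto
  qed
  then have "double_zero (chi0 g h c) z" using double_zero_chi0_iff assms zero by simp
  then show ?thesis using zpos by blast
qed

text \<open>
  At a double zero the tangent is horizontal, so by convexity \<open>chi0\<close> is nonnegative for the larger
  speed; but it has dropped below zero at the double zero of the smaller speed.
\<close>

lemma double_zero_speed_not_less:
  assumes g: "deriv g 0 > 1" and h: "h > 0"
    and "z > 0" "double_zero (chi0 g h c) z"
    and "z' > 0" "double_zero (chi0 g h c') z'"
  shows "\<not> c < c'"
proof
  assume "c < c'"
  have "chi0 g h c' z < chi0 g h c z"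
    using chi0_strict_antimono_speed[of g h z c c'] assms \<open>c < c'\<close> by simp
  also have "\<dots> = 0" using assms by (simp add: double_zero_def)
  finally have "chi0 g h c' z < 0" .
  moreover have "chi0 g h c' z \<ge> 0"
    using chi0_above_tangent[of g h c' z' z] assms by (simp add: double_zero_def)
  ultimately show False by simp
qed

lemma double_zero_at_c_sharp:
  assumes "deriv g 0 > 1" "h > 0"
  shows "\<exists>z>0. double_zero (chi0 g h (c_sharp g h)) z"
  unfolding c_sharp_def
proof (rule theI')
  show "\<exists>!c. \<exists>z>0. double_zero (chi0 g h c) z"
    using ex_double_zero[OF assms] double_zero_speed_not_less[OF assms]
    by (metis linorder_neqE_linordered_idom)
qed

lemma supercritical_speed:
  assumes "deriv g 0 > 1" "h > 0" "c > c_sharp g h"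
  shows "c > 0" "\<exists>z>0. chi0 g h c z < 0"
proof -
  obtain z where z: "z > 0" "double_zero (chi0 g h (c_sharp g h)) z"
    using double_zero_at_c_sharp[OF assms(1,2)] by blast
  have "chi0 g h (c_sharp g h) z = 0" using z by (simp add: double_zero_def)
  then have neg: "chi0 g h c z < 0"
    using chi0_strict_antimono_speed[of g h z "c_sharp g h" c] assms z by simp
  then show "\<exists>z>0. chi0 g h c z < 0" using z by blast
  show "c > 0"
    using chi0_pos_of_nonpos_speed[of g h z c] assms z neg by (cases "c \<le> 0") auto
qed

lemma convex_on_neg_on_segment:
  fixes f :: "real \<Rightarrow> real"
  assumes f: "convex_on UNIV f" and "f p \<le> 0" "f m < 0" "x \<in> closed_segment p m" "x \<noteq> p"
  shows "f x < 0"
proof -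
  obtain s where s: "0 \<le> s" "s \<le> 1" "x = (1 - s) * p + s * m"
    using assms(4) by (auto simp: closed_segment_def)
  then have "s > 0" using assms(5) by (cases "s = 0") auto
  have "f x \<le> (1 - s) * f p + s * f m"
    using convex_onD[OF f, of s p m] s by simp
  also have "\<dots> < 0"
    using assms(2,3) s \<open>s > 0\<close> by (intro add_nonpos_neg mult_nonneg_nonpos mult_pos_neg) auto
  finally show ?thesis .
qed

text \<open>
  By convexity a zero of \<open>chi0\<close> on either side of a point of negativity is the only one on that side.
  Thus the zeros found by the intermediate value theorem are the least and the greatest one, and
  \<open>chi0\<close> lies below its chords in between.
\<close>

lemma chi0_neg_between_lambda:
  assumes "deriv g 0 > 1" "h > 0" "c > c_sharp g h"
    and "lambda1 g h c < l" "l < lambda2 g h c"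
  shows "l > 0" "chi0 g h c l < 0"
proof -
  let ?f = "chi0 g h c"
  have conv: "convex_on UNIV ?f" using convex_on_chi0 assms by simp
  obtain m where m: "m > 0" "?f m < 0" and c: "c > 0"
    using supercritical_speed[OF assms(1-3)] by blast
  have cont: "continuous_on S ?f" for S
    unfolding chi0_def by (intro continuous_intros)
  have "\<exists>a\<ge>0. a \<le> m \<and> ?f a = 0"
    by (rule IVT2') (use m chi0_zero_pos[OF assms(1)] cont in \<open>auto intro: less_imp_le\<close>)
  then obtain a where a: "a \<ge> 0" "a \<le> m" "?f a = 0" by blast
  have "a \<noteq> 0" "a \<noteq> m" using a m chi0_zero_pos[OF assms(1), of h c] by auto
  then have a': "a > 0" "a < m" using a by auto
  have "\<exists>b\<ge>m. b \<le> max m (c + 1) \<and> ?f b = 0"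
  proof (rule IVT')
    have "?f (max m (c + 1)) > 0" by (rule chi0_pos_at_large) (use assms c in auto)
    then show "0 \<le> ?f (max m (c + 1))" by simp
  qed (use m cont in auto)
  then obtain b where b: "b \<ge> m" "?f b = 0" by blast
  then have b': "b > m" using m by (cases "b = m") auto
  have least: "a \<le> z" if z: "?f z = 0" for z
  proof (rule ccontr)
    assume "\<not> ?thesis"
    then have "?f a < 0"
      by (intro convex_on_neg_on_segment[OF conv, of z m a])
         (use z m a' in \<open>auto simp: closed_segment_eq_real_ivl\<close>)
    then show False using a by simp
  qed
  have greatest: "z \<le> b" if z: "?f z = 0" for z
  proof (rule ccontr)
    assume "\<not> ?thesis"
    then have "?f b < 0"
      by (intro convex_on_neg_on_segment[OF conv, of z m b])
         (use z m b' in \<open>auto simp: closed_segment_eq_real_ivl\<close>)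
    then show False using b by simp
  qed
  have "lambda1 g h c = a"
    unfolding lambda1_def using a least by (intro Least_equality) auto
  moreover have "lambda2 g h c = b"
    unfolding lambda2_def using b greatest by (intro Greatest_equality) auto
  ultimately have l: "a < l" "l < b" using assms by auto
  show "l > 0" using l a' by simp
  show "?f l < 0"
    using convex_on_neg_on_segment[OF conv, of a m l] convex_on_neg_on_segment[OF conv, of b m l]
      l a a' b b' m by (cases "l \<le> m") (auto simp: closed_segment_eq_real_ivl)
qed

section \<open>Comparison on unbounded strips\<close>

lemma second_derivative_nonneg_at_local_min:
  fixes f :: "real \<Rightarrow> real"
  assumes f: "\<And>y. (f has_real_derivative f' y) (at y)"
    and f': "(f' has_real_derivative D) (at x)"
    and e: "e > 0" and min: "\<And>y. \<bar>x - y\<bar> < e \<Longrightarrow> f x \<le> f y"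
  shows "f' x = 0" "D \<ge> 0"
proof -
  show 0: "f' x = 0" by (rule DERIV_local_min[OF f e]) (use min in auto)
  show "D \<ge> 0"
  proof (rule ccontr)
    assume "\<not> ?thesis"
    then obtain d where d: "d > 0" "\<And>k. 0 < k \<Longrightarrow> k < d \<Longrightarrow> f' (x + k) < f' x"
      using DERIV_neg_dec_right[OF f'] by auto
    define k where "k = min d e / 2"
    have k: "0 < k" "k < d" "k < e" using d(1) e by (auto simp: k_def)
    have "\<exists>z>x. z < x + k \<and> f (x + k) - f x = (x + k - x) * f' z"
      by (rule MVT2) (use k f in auto)
    then obtain z where z: "x < z" "z < x + k" "f (x + k) - f x = k * f' z" by auto
    have "f' z < 0" using d(2)[of "z - x"] z 0 k by auto
    then have "k * f' z < 0" using k by (simp add: mult_pos_neg)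
    then show False using z min[of "x + k"] k by simp
  qed
qed

lemma left_derivative_nonpos_at_min:
  fixes f :: "real \<Rightarrow> real"
  assumes "(f has_real_derivative D) (at x)" "a < x" "\<And>y. a \<le> y \<Longrightarrow> y \<le> x \<Longrightarrow> f x \<le> f y"
  shows "D \<le> 0"
proof (rule ccontr)
  assume "\<not> ?thesis"
  then obtain d where d: "d > 0" "\<And>k. 0 < k \<Longrightarrow> k < d \<Longrightarrow> f (x - k) < f x"
    using DERIV_pos_inc_left[OF assms(1)] by auto
  define k where "k = min (d / 2) (x - a)"
  have "f (x - k) < f x" by (rule d(2)) (use d assms in \<open>auto simp: k_def\<close>)
  moreover have "f x \<le> f (x - k)" by (rule assms(3)) (use d assms in \<open>auto simp: k_def\<close>)
  ultimately show False by simp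
qed

text \<open>
  The supersolution \<open>W\<close> need not be smooth: at each point it only has to be touched from above by a
  smooth function \<open>P\<close> that satisfies the differential inequality there.  This suffices, because a
  minimum of \<open>W - w\<close> is also a minimum of \<open>P - w\<close>, and it admits pointwise minima of smooth
  supersolutions.  The term \<open>\<epsilon> * (1 + y\<^sup>2 + 2 * \<tau>)\<close> in the proof makes the difference coercive in
  space, so that a negative infimum is attained; the part \<open>2 * \<tau>\<close> offsets the second derivative of
  \<open>y\<^sup>2\<close>.
\<close>

lemma parabolic_comparison:
  fixes w W f wt wx wxx :: "real \<Rightarrow> real \<Rightarrow> real"
  assumes cont_w: "continuous_on ({0..T} \<times> UNIV) (\<lambda>(t, x). w t x)"
    and cont_W: "continuous_on ({0..T} \<times> UNIV) (\<lambda>(t, x). W t x)"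
    and bdd: "\<And>t x. 0 \<le> t \<Longrightarrow> t \<le> T \<Longrightarrow> w t x \<le> B"
    and nonneg: "\<And>t x. 0 \<le> t \<Longrightarrow> t \<le> T \<Longrightarrow> 0 \<le> W t x"
    and init: "\<And>x. w 0 x \<le> W 0 x"
    and eqn: "\<And>t x. 0 < t \<Longrightarrow> t \<le> T \<Longrightarrow>
       ((\<lambda>\<tau>. w \<tau> x) has_real_derivative wt t x) (at t) \<and>
       ((\<lambda>y. w t y) has_real_derivative wx t x) (at x) \<and>
       ((\<lambda>y. wx t y) has_real_derivative wxx t x) (at x) \<and>
       wt t x = wxx t x - w t x + f t x"
    and super: "\<And>t x. 0 < t \<Longrightarrow> t \<le> T \<Longrightarrow>
       \<exists>P Pt Px Pxx. (\<forall>\<tau> y. W \<tau> y \<le> P \<tau> y) \<and> P t x = W t x \<and>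
          ((\<lambda>\<tau>. P \<tau> x) has_real_derivative Pt) (at t) \<and>
          (\<forall>y. (P t has_real_derivative Px y) (at y)) \<and>
          (Px has_real_derivative Pxx) (at x) \<and>
          f t x \<le> Pt - Pxx + P t x"
    and t: "0 \<le> t" "t \<le> T"
  shows "w t x \<le> W t x"
proof (rule ccontr)
  assume "\<not> ?thesis"
  then have bad: "w t x - W t x > 0" by simp
  \<comment> \<open>With this \<open>\<epsilon>\<close> the penalty eats up only half of the violation at \<open>(t, x)\<close>.\<close>
  define \<epsilon> where "\<epsilon> = (w t x - W t x) / (2 * (1 + x\<^sup>2 + 2 * t))"
  have den: "1 + x\<^sup>2 + 2 * t > 0" using t by (simp add: add_pos_nonneg)
  have \<epsilon>: "\<epsilon> > 0" using bad den by (simp add: \<epsilon>_def)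
  define V where "V = (\<lambda>\<tau> y. W \<tau> y - w \<tau> y + \<epsilon> * (1 + y\<^sup>2 + 2 * \<tau>))"
  have "V t x = - (w t x - W t x) / 2"
    using den by (simp add: V_def \<epsilon>_def field_simps)
  then have Vneg: "V t x < 0" using bad by simp
  define R where "R = \<bar>x\<bar> + \<bar>B\<bar> / \<epsilon> + 1"
  have R: "R \<ge> 1" "\<bar>x\<bar> \<le> R" using \<epsilon> by (auto simp: R_def)
  have far: "V \<tau> y > 0" if "0 \<le> \<tau>" "\<tau> \<le> T" "\<bar>y\<bar> > R" for \<tau> y
  proof -
    have "\<bar>y\<bar> * \<bar>y\<bar> \<ge> R * 1" using that R by (intro mult_mono) auto
    then have "y\<^sup>2 \<ge> R" by (simp add: power2_eq_square)
    then have "\<epsilon> * (1 + y\<^sup>2 + 2 * \<tau>) \<ge> \<epsilon> * R" using that \<epsilon> by (intro mult_left_mono) auto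
    moreover have "\<epsilon> * R \<ge> \<bar>B\<bar> + \<epsilon>" using \<epsilon> by (simp add: R_def algebra_simps)
    ultimately show ?thesis
      unfolding V_def using bdd[OF that(1,2), of y] nonneg[OF that(1,2), of y] \<epsilon> by linarith
  qed
  have contV: "continuous_on ({0..T} \<times> {-R..R}) (\<lambda>k. V (fst k) (snd k))"
  proof -
    have 1: "continuous_on ({0..T} \<times> {-R..R}) (\<lambda>k. w (fst k) (snd k))"
      by (rule continuous_on_subset[OF cont_w[unfolded case_prod_unfold]]) auto
    have 2: "continuous_on ({0..T} \<times> {-R..R}) (\<lambda>k. W (fst k) (snd k))"
      by (rule continuous_on_subset[OF cont_W[unfolded case_prod_unfold]]) auto
    show ?thesis unfolding V_def by (intro continuous_intros 1 2)
  qed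
  have inK: "(t, x) \<in> {0..T} \<times> {-R..R}" using t R by auto
  obtain k where k: "k \<in> {0..T} \<times> {-R..R}"
      "\<And>k'. k' \<in> {0..T} \<times> {-R..R} \<Longrightarrow> V (fst k) (snd k) \<le> V (fst k') (snd k')"
    using continuous_attains_inf[OF compact_Times[OF compact_Icc compact_Icc] _ contV] inK by blast
  obtain t0 x0 where k0: "k = (t0, x0)" by (cases k)
  have t0: "0 \<le> t0" "t0 \<le> T" and x0: "\<bar>x0\<bar> \<le> R" using k(1) k0 by auto
  have V0: "V t0 x0 < 0" using k(2)[OF inK] k0 Vneg by simp
  have minV: "V t0 x0 \<le> V \<tau> y" if "0 \<le> \<tau>" "\<tau> \<le> T" for \<tau> y
  proof (cases "\<bar>y\<bar> > R")
    case True
    then show ?thesis using far[OF that True] V0 by simp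
  next
    case False
    then have "(\<tau>, y) \<in> {0..T} \<times> {-R..R}" using that by (auto simp: abs_le_iff)
    then show ?thesis using k(2) k0 by fastforce
  qed
  have "t0 \<noteq> 0"
  proof
    assume "t0 = 0"
    then have "V t0 x0 \<ge> \<epsilon> * (1 + x0\<^sup>2)" using init[of x0] by (simp add: V_def)
    moreover have "\<epsilon> * (1 + x0\<^sup>2) > 0" using \<epsilon> by (simp add: add_pos_nonneg)
    ultimately show False using V0 by simp
  qed
  then have t0': "t0 > 0" using t0 by simp
  obtain P Pt Px Pxx where P: "\<And>\<tau> y. W \<tau> y \<le> P \<tau> y" "P t0 x0 = W t0 x0"
      "((\<lambda>\<tau>. P \<tau> x0) has_real_derivative Pt) (at t0)"
      "\<And>y. (P t0 has_real_derivative Px y) (at y)"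
      "(Px has_real_derivative Pxx) (at x0)"
      "f t0 x0 \<le> Pt - Pxx + P t0 x0"
    using super[OF t0' t0(2), of x0] by blast
  note E = eqn[OF t0' t0(2)]
  define U where "U = (\<lambda>\<tau> y. P \<tau> y - w \<tau> y + \<epsilon> * (1 + y\<^sup>2 + 2 * \<tau>))"
  have UV: "U t0 x0 = V t0 x0" "\<And>\<tau> y. V \<tau> y \<le> U \<tau> y"
    using P(1,2) by (auto simp: U_def V_def)
  have minU: "U t0 x0 \<le> U \<tau> y" if "0 \<le> \<tau>" "\<tau> \<le> T" for \<tau> y
    using minV[OF that, of y] UV by (metis order_trans)
  have "Pt - wt t0 x0 + 2 * \<epsilon> \<le> 0"
  proof (rule left_derivative_nonpos_at_min[where a = 0])
    show "((\<lambda>\<tau>. U \<tau> x0) has_real_derivative Pt - wt t0 x0 + 2 * \<epsilon>) (at t0)"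
      unfolding U_def using E[of x0] P(3) by (auto intro!: derivative_eq_intros)
  qed (use t0' t0 minU in auto)
  moreover have "Pxx - wxx t0 x0 + 2 * \<epsilon> \<ge> 0"
  proof (rule second_derivative_nonneg_at_local_min(2)[OF _ _ zero_less_one])
    show "(U t0 has_real_derivative Px y - wx t0 y + 2 * \<epsilon> * y) (at y)" for y
      unfolding U_def using E[of y] P(4)[of y] by (auto intro!: derivative_eq_intros)
    show "((\<lambda>y. Px y - wx t0 y + 2 * \<epsilon> * y) has_real_derivative Pxx - wxx t0 x0 + 2 * \<epsilon>) (at x0)"
      using E[of x0] P(5) by (auto intro!: derivative_eq_intros)
  qed (use t0 minU in auto)
  moreover have "wt t0 x0 = wxx t0 x0 - w t0 x0 + f t0 x0" using E by blast
  moreover have "P t0 x0 - w t0 x0 + \<epsilon> * (1 + x0\<^sup>2 + 2 * t0) < 0"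
    using V0 UV by (simp add: U_def)
  moreover have "\<epsilon> * (1 + x0\<^sup>2 + 2 * t0) \<ge> 0" using \<epsilon> t0 by simp
  ultimately show False using P(6) by linarith
qed

text \<open>
  First and second derivatives at \<open>z\<close> of smooth functions touching \<open>m\<close> from above at \<open>z\<close>: the second
  order superjet of viscosity theory, here with a global majorant.
\<close>

definition superjet :: "(real \<Rightarrow> real) \<Rightarrow> real \<Rightarrow> real \<Rightarrow> real \<Rightarrow> bool" where
  "superjet m z a b \<longleftrightarrow>
     (\<exists>p p'. (\<forall>y. m y \<le> p y) \<and> p z = m z \<and>
        (\<forall>y. (p has_real_derivative p' y) (at y)) \<and> p' z = a \<and>
        (p' has_real_derivative b) (at z))"

text \<open>
  The method of steps: the bound on \<open>[0, nh]\<close> controls the source \<open>f\<close> on \<open>[0, (n+1)h]\<close>, where the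
  comparison principle applies to \<open>w\<close> and to \<open>- w\<close>.  For the function \<open>K exp(-\<gamma> t) m(x + ct)\<close> the
  operator \<open>\<partial>\<^sub>t - \<partial>\<^sub>x\<^sub>x + 1\<close> becomes \<open>c m' - m'' + (1 - \<gamma>) m\<close> in the moving coordinate, with a superjet in
  place of the derivatives.  In the premise \<open>step\<close> the past bound is offered only for \<open>t \<ge> h\<close>; for
  \<open>t < h\<close> the source depends on the initial data.
\<close>

lemma delayed_comparison:
  fixes w f wt wx wxx :: "real \<Rightarrow> real \<Rightarrow> real"
  assumes h: "h > 0"
    and cont_w: "continuous_on ({0..} \<times> UNIV) (\<lambda>(t, x). w t x)"
    and bdd: "\<And>T. bounded ((\<lambda>(t, x). w t x) ` ({0..T} \<times> UNIV))"
    and eqn: "\<And>t x. 0 < t \<Longrightarrow>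
       ((\<lambda>\<tau>. w \<tau> x) has_real_derivative wt t x) (at t) \<and>
       ((\<lambda>y. w t y) has_real_derivative wx t x) (at x) \<and>
       ((\<lambda>y. wx t y) has_real_derivative wxx t x) (at x) \<and>
       wt t x = wxx t x - w t x + f t x"
    and cont_m: "continuous_on UNIV m" and m: "\<And>z. m z \<ge> 0" and K: "K \<ge> 0"
    and init: "\<And>x. \<bar>w 0 x\<bar> \<le> K * m x"
    and step: "\<And>t x. 0 < t \<Longrightarrow>
       (h \<le> t \<Longrightarrow> \<bar>w (t - h) x\<bar> \<le> K * exp (- \<gamma> * (t - h)) * m (x + c * (t - h))) \<Longrightarrow>
       \<exists>a b. superjet m (x + c * t) a b \<and>
         \<bar>f t x\<bar> \<le> K * exp (- \<gamma> * t) * (c * a - b + (1 - \<gamma>) * m (x + c * t))"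
    and t: "t \<ge> 0"
  shows "\<bar>w t x\<bar> \<le> K * exp (- \<gamma> * t) * m (x + c * t)"
proof -
  define W where "W = (\<lambda>t x. K * exp (- \<gamma> * t) * m (x + c * t))"
  have cont_W: "continuous_on S (\<lambda>(t, x). W t x)" for S
    unfolding W_def case_prod_unfold
    by (intro continuous_intros continuous_on_compose2[OF cont_m]) auto
  have W0: "W t x \<ge> 0" for t x using m K by (simp add: W_def)
  have main: "\<forall>t x. 0 \<le> t \<and> t \<le> real n * h \<longrightarrow> \<bar>w t x\<bar> \<le> W t x" for n
  proof (induction n)
    case 0
    then show ?case using init by (auto simp: W_def)
  next
    case (Suc n)
    define T where "T = real (Suc n) * h"
    obtain B where B: "\<And>t x. 0 \<le> t \<Longrightarrow> t \<le> T \<Longrightarrow> \<bar>w t x\<bar> \<le> B"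
      using bdd[of T] unfolding bounded_iff by force
    have cont: "continuous_on ({0..T} \<times> UNIV) (\<lambda>(t, x). w t x)"
      by (rule continuous_on_subset[OF cont_w]) auto
    have super: "\<exists>P Pt Px Pxx. (\<forall>\<tau> y. W \<tau> y \<le> P \<tau> y) \<and> P t x = W t x \<and>
          ((\<lambda>\<tau>. P \<tau> x) has_real_derivative Pt) (at t) \<and>
          (\<forall>y. (P t has_real_derivative Px y) (at y)) \<and>
          (Px has_real_derivative Pxx) (at x) \<and>
          \<bar>f t x\<bar> \<le> Pt - Pxx + P t x" if t: "0 < t" "t \<le> T" for t x
    proof -
      have "\<bar>w (t - h) x\<bar> \<le> K * exp (- \<gamma> * (t - h)) * m (x + c * (t - h))" if "h \<le> t"
      proof -
        have "t - h \<le> real n * h" using t by (simp add: T_def algebra_simps)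
        then show ?thesis using Suc.IH that unfolding W_def by simp
      qed
      from step[OF t(1) this] obtain a b where ab: "superjet m (x + c * t) a b"
        and fb: "\<bar>f t x\<bar> \<le> K * exp (- \<gamma> * t) * (c * a - b + (1 - \<gamma>) * m (x + c * t))"
        by blast
      obtain p p' where p: "\<And>y. m y \<le> p y" "p (x + c * t) = m (x + c * t)"
          "\<And>y. (p has_real_derivative p' y) (at y)" "p' (x + c * t) = a"
          "(p' has_real_derivative b) (at (x + c * t))"
        using ab unfolding superjet_def by blast
      have dt: "((\<lambda>\<tau>. K * exp (- \<gamma> * \<tau>) * p (x + c * \<tau>)) has_real_derivative
          K * exp (- \<gamma> * t) * (c * a - \<gamma> * m (x + c * t))) (at t)"
        by (rule derivative_eq_intros DERIV_chain2[where f = p, OF p(3)] refl)+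
           (simp add: p algebra_simps)
      have dx: "((\<lambda>y. K * exp (- \<gamma> * t) * p (y + c * t)) has_real_derivative
          K * exp (- \<gamma> * t) * p' (y + c * t)) (at y)" for y
        by (rule derivative_eq_intros DERIV_chain2[where f = p, OF p(3)] refl)+ simp
      have dxx: "((\<lambda>y. K * exp (- \<gamma> * t) * p' (y + c * t)) has_real_derivative
          K * exp (- \<gamma> * t) * b) (at x)"
        by (rule derivative_eq_intros DERIV_chain2[where f = p' and g = "\<lambda>y. y + c * t", OF p(5)] refl)+ simp
      have above: "W \<tau> y \<le> K * exp (- \<gamma> * \<tau>) * p (y + c * \<tau>)" for \<tau> y
        unfolding W_def using p(1) K by (intro mult_left_mono) auto
      have "\<bar>f t x\<bar> \<le> K * exp (- \<gamma> * t) * (c * a - \<gamma> * m (x + c * t)) - K * exp (- \<gamma> * t) * b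
          + K * exp (- \<gamma> * t) * p (x + c * t)"
        using fb by (simp add: p algebra_simps)
      then show ?thesis
        by (intro exI[of _ "\<lambda>\<tau> y. K * exp (- \<gamma> * \<tau>) * p (y + c * \<tau>)"]
              exI[of _ "K * exp (- \<gamma> * t) * (c * a - \<gamma> * m (x + c * t))"]
              exI[of _ "\<lambda>y. K * exp (- \<gamma> * t) * p' (y + c * t)"]
              exI[of _ "K * exp (- \<gamma> * t) * b"])
           (use above dt dx dxx in \<open>simp add: W_def p(2)\<close>)
    qed
    have upper: "w t x \<le> W t x" if "0 \<le> t" "t \<le> T" for t x
    proof (rule parabolic_comparison[OF cont cont_W _ W0 _ _ _ that])
      show "w t x \<le> B" if "0 \<le> t" "t \<le> T" for t x using B[OF that, of x] by simp
      show "w 0 x \<le> W 0 x" for x using init[of x] by (simp add: W_def)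
      show "((\<lambda>\<tau>. w \<tau> x) has_real_derivative wt t x) (at t) \<and>
         (w t has_real_derivative wx t x) (at x) \<and>
         (wx t has_real_derivative wxx t x) (at x) \<and>
         wt t x = wxx t x - w t x + f t x" if "0 < t" for t x using eqn[OF that] by blast
      show "\<exists>P Pt Px Pxx. (\<forall>\<tau> y. W \<tau> y \<le> P \<tau> y) \<and> P t x = W t x \<and>
          ((\<lambda>\<tau>. P \<tau> x) has_real_derivative Pt) (at t) \<and>
          (\<forall>y. (P t has_real_derivative Px y) (at y)) \<and>
          (Px has_real_derivative Pxx) (at x) \<and> f t x \<le> Pt - Pxx + P t x"
        if t: "0 < t" "t \<le> T" for t x
      proof -
        obtain P Pt Px Pxx where P: "\<forall>\<tau> y. W \<tau> y \<le> P \<tau> y" "P t x = W t x"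
          "((\<lambda>\<tau>. P \<tau> x) has_real_derivative Pt) (at t)"
          "\<forall>y. (P t has_real_derivative Px y) (at y)"
          "(Px has_real_derivative Pxx) (at x)" "\<bar>f t x\<bar> \<le> Pt - Pxx + P t x"
          using super[OF t, of x] by blast
        show ?thesis 
          by (intro exI[of _ P] exI[of _ Pt] exI[of _ Px] exI[of _ Pxx] conjI P(1-5) abs_le_D1[OF P(6)])
      qed
    qed
    have lower: "- w t x \<le> W t x" if "0 \<le> t" "t \<le> T" for t x
    proof (rule parabolic_comparison[OF _ cont_W _ W0 _ _ _ that, where w = "\<lambda>t x. - w t x"])
      show "continuous_on ({0..T} \<times> UNIV) (\<lambda>(t, x). - w t x)"
        using continuous_on_minus[OF cont] by (simp add: case_prod_unfold)
      show "- w t x \<le> B" if "0 \<le> t" "t \<le> T" for t x using B[OF that, of x] by simp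
      show "- w 0 x \<le> W 0 x" for x using init[of x] by (simp add: W_def)
      show "((\<lambda>\<tau>. - w \<tau> x) has_real_derivative - wt t x) (at t) \<and>
         ((\<lambda>x. - w t x) has_real_derivative - wx t x) (at x) \<and>
         ((\<lambda>x. - wx t x) has_real_derivative - wxx t x) (at x) \<and>
         - wt t x = - wxx t x - - w t x + - f t x" if "0 < t" for t x
      proof (intro conjI)
        note E = eqn[OF that, of x]
        show "((\<lambda>\<tau>. - w \<tau> x) has_real_derivative - wt t x) (at t)" using E by (intro DERIV_minus) blast
        show "((\<lambda>x. - w t x) has_real_derivative - wx t x) (at x)" using E by (intro DERIV_minus) blast
        show "((\<lambda>x. - wx t x) has_real_derivative - wxx t x) (at x)" using E by (intro DERIV_minus) blast
        show "- wt t x = - wxx t x - - w t x + - f t x" using E by simp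
      qed
      show "\<exists>P Pt Px Pxx. (\<forall>\<tau> y. W \<tau> y \<le> P \<tau> y) \<and> P t x = W t x \<and>
          ((\<lambda>\<tau>. P \<tau> x) has_real_derivative Pt) (at t) \<and>
          (\<forall>y. (P t has_real_derivative Px y) (at y)) \<and>
          (Px has_real_derivative Pxx) (at x) \<and> - f t x \<le> Pt - Pxx + P t x"
        if t: "0 < t" "t \<le> T" for t x
      proof -
        obtain P Pt Px Pxx where P: "\<forall>\<tau> y. W \<tau> y \<le> P \<tau> y" "P t x = W t x"
          "((\<lambda>\<tau>. P \<tau> x) has_real_derivative Pt) (at t)"
          "\<forall>y. (P t has_real_derivative Px y) (at y)"
          "(Px has_real_derivative Pxx) (at x)" "\<bar>f t x\<bar> \<le> Pt - Pxx + P t x"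
          using super[OF t, of x] by blast
        show ?thesis 
          by (intro exI[of _ P] exI[of _ Pt] exI[of _ Px] exI[of _ Pxx] conjI P(1-5) abs_le_D2[OF P(6)])
      qed
    qed
    show ?case using upper lower unfolding T_def by (auto simp: abs_le_iff)
  qed
  obtain n where "t / h \<le> real n" using real_arch_simple by blast
  then have "t \<le> real n * h" using h by (simp add: field_simps)
  then show ?thesis using main t unfolding W_def by blast
qed


lemma superjet_of_majorant:
  assumes "\<And>y. m y \<le> p y" "p z = m z" "\<And>y. (p has_real_derivative p' y) (at y)"
    "(p' has_real_derivative b) (at z)"
  shows "superjet m z (p' z) b"
  using assms unfolding superjet_def by blast

section \<open>Deviation from a semi-wavefront\<close>

lemma lipschitz_on_line:
  assumes H: "hyp_H g \<kappa> (deriv g 0)"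
  shows "\<bar>g u - g v\<bar> \<le> deriv g 0 * \<bar>u - v\<bar>"
proof -
  let ?L = "deriv g 0"
  have L: "?L > 1" and neg: "\<And>x. x \<le> 0 \<Longrightarrow> g x = ?L * x"
    and pos: "\<And>u v. u \<ge> 0 \<Longrightarrow> v \<ge> 0 \<Longrightarrow> \<bar>g u - g v\<bar> \<le> ?L * \<bar>u - v\<bar>"
    using H unfolding hyp_H_def by blast+
  have mixed: "\<bar>g u - g v\<bar> \<le> ?L * \<bar>u - v\<bar>" if "u \<le> 0" "0 \<le> v" for u v
  proof -
    have "\<bar>g u - g v\<bar> \<le> \<bar>g u - g 0\<bar> + \<bar>g 0 - g v\<bar>" by simp
    also have "\<dots> \<le> ?L * \<bar>u\<bar> + ?L * \<bar>v\<bar>"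
      using pos[of 0 v] neg[of u] neg[of 0] that L by (simp add: abs_mult)
    also have "\<dots> = ?L * \<bar>u - v\<bar>" using that by (simp add: algebra_simps)
    finally show ?thesis .
  qed
  consider "u \<le> 0" "v \<le> 0" | "u \<le> 0" "0 \<le> v" | "0 \<le> u" "v \<le> 0" | "0 \<le> u" "0 \<le> v" by linarith
  then show ?thesis
  proof cases
    case 1
    then show ?thesis using neg L by (simp add: abs_mult flip: right_diff_distrib)
  next
    case 3
    then show ?thesis using mixed[of v u] by (simp add: abs_minus_commute)
  qed (use mixed pos in auto)
qed

text \<open>
  The time derivative of \<open>\<phi>(x + ct)\<close> is \<open>c \<phi>'\<close>, which turns the equation at \<open>t = 0\<close> into an ordinary
  delay equation for the profile.
\<close>

lemma semi_wavefront_ode: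
  assumes "semi_wavefront g h c \<phi>"
  obtains \<phi>' \<phi>'' where "\<And>z. (\<phi> has_real_derivative \<phi>' z) (at z)"
    "\<And>z. (\<phi>' has_real_derivative \<phi>'' z) (at z)"
    "\<And>z. \<phi>'' z = c * \<phi>' z + \<phi> z - g (\<phi> (z - c * h))"
proof -
  obtain ut ux uxx where D: "\<And>t x. ((\<lambda>\<tau>. \<phi> (x + c * \<tau>)) has_real_derivative ut t x) (at t)"
      "\<And>t x. ((\<lambda>y. \<phi> (y + c * t)) has_real_derivative ux t x) (at x)"
      "\<And>t x. ((\<lambda>y. ux t y) has_real_derivative uxx t x) (at x)"
      "\<And>t x. ut t x = uxx t x - \<phi> (x + c * t) + g (\<phi> (x + c * (t - h)))"
    using assms unfolding semi_wavefront_def classical_on_def by blast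
  have \<phi>': "(\<phi> has_real_derivative ux 0 z) (at z)" for z using D(2)[of 0 z] by simp
  have "((\<lambda>\<tau>. \<phi> (z + c * \<tau>)) has_real_derivative ux 0 z * c) (at 0)" for z
    by (rule DERIV_chain2[where f = \<phi>]) (auto intro!: derivative_eq_intros simp: \<phi>')
  then have "ut 0 z = ux 0 z * c" for z using D(1)[of z 0] DERIV_unique by blast
  then have "uxx 0 z = c * ux 0 z + \<phi> z - g (\<phi> (z - c * h))" for z
    using D(4)[of 0 z] by (simp add: algebra_simps)
  with \<phi>' D(3) show thesis by (rule that)
qed

lemma semi_wavefront_continuous:
  assumes "semi_wavefront g h c \<phi>"
  shows "continuous_on S \<phi>"
proof -
  obtain \<phi>' \<phi>'' where "\<And>z. (\<phi> has_real_derivative \<phi>' z) (at z)"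
    using semi_wavefront_ode[OF assms] by metis
  then show ?thesis by (meson DERIV_isCont continuous_at_imp_continuous_on)
qed

lemma stability_by_supersolution:
  assumes h: "h > 0" and wave: "semi_wavefront g h c \<phi>" and sol: "is_solution g h w\<^sub>0 u"
    and cont_m: "continuous_on UNIV m" and m: "\<And>z. m z \<ge> 0" and K: "K \<ge> 0"
    and init: "\<And>x. \<bar>u 0 x - \<phi> x\<bar> \<le> K * m x"
    and step: "\<And>t x. 0 < t \<Longrightarrow>
       (h \<le> t \<Longrightarrow> \<bar>u (t - h) x - \<phi> (x + c * (t - h))\<bar>
          \<le> K * exp (- \<gamma> * (t - h)) * m (x + c * (t - h))) \<Longrightarrow>
       \<exists>a b. superjet m (x + c * t) a b \<and>
         \<bar>g (u (t - h) x) - g (\<phi> (x + c * (t - h)))\<bar>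
           \<le> K * exp (- \<gamma> * t) * (c * a - b + (1 - \<gamma>) * m (x + c * t))"
    and t: "t \<ge> 0"
  shows "\<bar>u t x - \<phi> (x + c * t)\<bar> \<le> K * exp (- \<gamma> * t) * m (x + c * t)"
proof -
  obtain ut ux uxx where U: "\<And>t x. 0 < t \<Longrightarrow> ((\<lambda>\<tau>. u \<tau> x) has_real_derivative ut t x) (at t)"
      "\<And>t x. 0 < t \<Longrightarrow> ((\<lambda>y. u t y) has_real_derivative ux t x) (at x)"
      "\<And>t x. 0 < t \<Longrightarrow> ((\<lambda>y. ux t y) has_real_derivative uxx t x) (at x)"
      "\<And>t x. 0 < t \<Longrightarrow> ut t x = uxx t x - u t x + g (u (t - h) x)"
    using sol unfolding is_solution_def classical_on_def greaterThan_iff by blast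
  obtain vt vx vxx where V: "\<And>t x. ((\<lambda>\<tau>. \<phi> (x + c * \<tau>)) has_real_derivative vt t x) (at t)"
      "\<And>t x. ((\<lambda>y. \<phi> (y + c * t)) has_real_derivative vx t x) (at x)"
      "\<And>t x. ((\<lambda>y. vx t y) has_real_derivative vxx t x) (at x)"
      "\<And>t x. vt t x = vxx t x - \<phi> (x + c * t) + g (\<phi> (x + c * (t - h)))"
    using wave unfolding semi_wavefront_def classical_on_def by blast
  show ?thesis
  proof (rule delayed_comparison[where w = "\<lambda>t x. u t x - \<phi> (x + c * t)"
        and f = "\<lambda>t x. g (u (t - h) x) - g (\<phi> (x + c * (t - h)))"
        and wt = "\<lambda>t x. ut t x - vt t x" and wx = "\<lambda>t x. ux t x - vx t x"
        and wxx = "\<lambda>t x. uxx t x - vxx t x", OF h _ _ _ cont_m m K _ step t])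
    have "continuous_on ({0..} \<times> UNIV) (\<lambda>(t, x). u t x)"
      using sol h unfolding is_solution_def by (auto elim: continuous_on_subset)
    then show "continuous_on ({0..} \<times> UNIV) (\<lambda>(t, x). u t x - \<phi> (x + c * t))"
      unfolding case_prod_unfold
      by (intro continuous_intros continuous_on_compose2[OF semi_wavefront_continuous[OF wave, of UNIV]])
         auto
    show "bounded ((\<lambda>(t, x). u t x - \<phi> (x + c * t)) ` ({0..T} \<times> UNIV))" for T
    proof -
      obtain A where A: "\<And>t x. t \<in> {-h..T} \<Longrightarrow> \<bar>u t x\<bar> \<le> A"
        using sol unfolding is_solution_def bounded_iff by force
      obtain B where B: "\<And>z. \<bar>\<phi> z\<bar> \<le> B"
        using wave unfolding semi_wavefront_def bounded_iff by force
      have "\<bar>u t x - \<phi> (x + c * t)\<bar> \<le> A + B" if "t \<in> {0..T}" for t x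
        using A[of t x] B[of "x + c * t"] that h by simp
      then show ?thesis unfolding bounded_iff by (auto intro!: exI[of _ "A + B"])
    qed
    show "((\<lambda>\<tau>. u \<tau> x - \<phi> (x + c * \<tau>)) has_real_derivative ut t x - vt t x) (at t) \<and>
       ((\<lambda>y. u t y - \<phi> (y + c * t)) has_real_derivative ux t x - vx t x) (at x) \<and>
       ((\<lambda>y. ux t y - vx t y) has_real_derivative uxx t x - vxx t x) (at x) \<and>
       ut t x - vt t x = uxx t x - vxx t x - (u t x - \<phi> (x + c * t))
          + (g (u (t - h) x) - g (\<phi> (x + c * (t - h))))" if "0 < t" for t x
      using U[OF that] V by (auto intro!: derivative_intros)
  qed (use init in auto)
qed

section \<open>Exponential weights\<close>

lemma ex_small_rate:
  assumes "(r::real) > 0"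
  shows "\<exists>\<gamma>>0. \<gamma> + A * (exp (\<gamma> * h) - 1) < r"
proof -
  have "((\<lambda>\<gamma>. \<gamma> + A * (exp (\<gamma> * h) - 1)) \<longlongrightarrow> 0 + A * (exp (0 * h) - 1)) (at_right 0)"
    by (intro tendsto_intros)
  then have "eventually (\<lambda>\<gamma>. \<gamma> + A * (exp (\<gamma> * h) - 1) < r) (at_right 0)"
    by (rule order_tendstoD(2)) (use assms in simp)
  moreover have "eventually (\<lambda>\<gamma>::real. \<gamma> > 0) (at_right 0)" by (rule eventually_at_right_less)
  ultimately have "eventually (\<lambda>\<gamma>. \<gamma> + A * (exp (\<gamma> * h) - 1) < r \<and> \<gamma> > 0) (at_right 0)"
    by (rule eventually_conj)
  then show ?thesis using eventually_happens by fastforce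
qed

text \<open>
  The supersolution inequality for \<open>exp (l * y)\<close>.  Dividing by this exponential leaves
  \<open>c l - l\<^sup>2 + 1 - \<gamma> \<ge> g'(0) exp(-lch) exp(\<gamma> h)\<close>, which is the first assumption.
\<close>

lemma exponential_residual:
  assumes "\<gamma> + deriv g 0 * exp (- l * c * h) * (exp (\<gamma> * h) - 1) \<le> - chi0 g h c l"
    and "K \<ge> 0" and "D \<le> K * exp (- \<gamma> * (t - h)) * exp (l * (y - c * h))" and "deriv g 0 \<ge> 0"
  shows "deriv g 0 * D
    \<le> K * exp (- \<gamma> * t) * (c * (l * exp (l * y)) - l * (l * exp (l * y)) + (1 - \<gamma>) * exp (l * y))"
proof -
  let ?E = "K * exp (- \<gamma> * t) * exp (l * y)"
  have "deriv g 0 * D \<le> deriv g 0 * (K * exp (- \<gamma> * (t - h)) * exp (l * (y - c * h)))"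
    using assms by (intro mult_left_mono) auto
  also have "\<dots> = ?E * (deriv g 0 * exp (- l * c * h) * exp (\<gamma> * h))"
    by (simp add: algebra_simps flip: exp_add)
  also have "\<dots> \<le> ?E * (c * l - l * l + (1 - \<gamma>))"
    using assms by (intro mult_left_mono) (auto simp: chi0_def power2_eq_square algebra_simps)
  finally show ?thesis by (simp add: algebra_simps)
qed

lemma has_derivative_exp_shift:
  "((\<lambda>y. exp (l * (y - b))) has_real_derivative l * exp (l * (y - b))) (at y)"
  "((\<lambda>y. l * exp (l * (y - b))) has_real_derivative l * (l * exp (l * (y - b)))) (at y)"
  by (auto intro!: derivative_eq_intros)

lemma weighted_bound_of_SUP:
  assumes "(SUP s\<in>I. wnorm l (f s)) < \<infinity>"
  obtains M where "M \<ge> 0" "\<And>s x. s \<in> I \<Longrightarrow> \<bar>f s x\<bar> \<le> M * exp (l * x)"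
proof -
  obtain r where r: "(SUP s\<in>I. wnorm l (f s)) \<le> ereal r"
    using assms by (cases "SUP s\<in>I. wnorm l (f s)") auto
  have "\<bar>f s x\<bar> \<le> max r 0 * exp (l * x)" if "s \<in> I" for s x
  proof -
    have "ereal (\<bar>f s x\<bar> / eta l x) \<le> wnorm l (f s)"
      unfolding wnorm_def by (rule SUP_upper) simp
    also have "\<dots> \<le> ereal r" using r that by (meson SUP_upper order_trans)
    finally have "\<bar>f s x\<bar> / eta l x \<le> max r 0" by simp
    then have "\<bar>f s x\<bar> \<le> max r 0 * eta l x" by (simp add: eta_def field_simps split: if_splits)
    also have "\<dots> \<le> max r 0 * exp (l * x)" by (intro mult_left_mono) (auto simp: eta_def)
    finally show ?thesis .
  qed
  then show thesis by (intro that[of "max r 0"]) auto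
qed

lemma global_stability_exponential_weight:
  assumes h: "h > 0" and H: "hyp_H g \<kappa> (deriv g 0)" and c: "c > 0"
    and l: "l > 0" and chi: "chi0 g h c l < 0"
    and wave: "semi_wavefront g h c \<phi>" and sol: "is_solution g h w\<^sub>0 u"
    and fin: "(SUP s\<in>{-h..0}. wnorm l (\<lambda>x. \<phi> (x + c * s) - w\<^sub>0 s x)) < \<infinity>"
  shows "\<exists>C>0. \<exists>\<gamma>>0. \<forall>t\<ge>0. \<forall>x.
     \<bar>u t x - \<phi> (x + c * t)\<bar> \<le> C * exp (- \<gamma> * t) * exp (l * (x + c * t))"
proof -
  obtain M where M: "M \<ge> 0"
      "\<And>s x. s \<in> {-h..0} \<Longrightarrow> \<bar>\<phi> (x + c * s) - w\<^sub>0 s x\<bar> \<le> M * exp (l * x)"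
    using weighted_bound_of_SUP[OF fin] by blast
  \<comment> \<open>The weight of the hypothesis is centred at \<open>x\<close>, the supersolution at \<open>x + c * s\<close>; the factor
      \<open>exp (l * (c * h))\<close> pays for the shift.\<close>
  define C where "C = (M + 1) * exp (l * (c * h))"
  have C: "C > 0" using M by (simp add: C_def)
  have L: "deriv g 0 > 1" using H by (simp add: hyp_H_def)
  obtain \<gamma> where \<gamma>: "\<gamma> > 0"
      "\<gamma> + deriv g 0 * exp (- l * c * h) * (exp (\<gamma> * h) - 1) < - chi0 g h c l"
    using ex_small_rate[of "- chi0 g h c l" "deriv g 0 * exp (- l * c * h)" h] chi by auto
  have history: "\<bar>u s x - \<phi> (x + c * s)\<bar> \<le> C * exp (- \<gamma> * s) * exp (l * (x + c * s))"
    if s: "s \<in> {-h..0}" for s x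
  proof -
    have "\<bar>u s x - \<phi> (x + c * s)\<bar> \<le> M * exp (l * x)"
      using M(2)[OF s, of x] sol s by (simp add: is_solution_def abs_minus_commute)
    also have "\<dots> \<le> (M + 1) * exp (- \<gamma> * s + (l * (c * h) + l * (x + c * s)))"
    proof (intro mult_mono)
      have "- \<gamma> * s \<ge> 0" using \<gamma> s by (simp add: mult_nonneg_nonpos)
      moreover have "l * c * (h + s) \<ge> 0" using l c s by simp
      ultimately show "exp (l * x) \<le> exp (- \<gamma> * s + (l * (c * h) + l * (x + c * s)))"
        by (simp add: algebra_simps)
    qed (use M in auto)
    also have "\<dots> = C * exp (- \<gamma> * s) * exp (l * (x + c * s))"
      by (simp only: C_def exp_add mult_ac)
    finally show ?thesis .
  qed
  have "\<bar>u t x - \<phi> (x + c * t)\<bar> \<le> C * exp (- \<gamma> * t) * exp (l * (x + c * t))" if "t \<ge> 0" for t x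
  proof (rule stability_by_supersolution[OF h wave sol _ _ _ _ _ that, where m = "\<lambda>z. exp (l * z)"])
    show "\<bar>u 0 x - \<phi> x\<bar> \<le> C * exp (l * x)" for x using history[of 0 x] h by simp
    fix t x :: real
    assume t: "0 < t" and past: "h \<le> t \<Longrightarrow> \<bar>u (t - h) x - \<phi> (x + c * (t - h))\<bar>
          \<le> C * exp (- \<gamma> * (t - h)) * exp (l * (x + c * (t - h)))"
    let ?z = "x + c * t"
    have jet: "superjet (\<lambda>z. exp (l * z)) ?z (l * exp (l * ?z)) (l * (l * exp (l * ?z)))"
      using superjet_of_majorant[where m = "\<lambda>z. exp (l * z)" and p = "\<lambda>z. exp (l * z)" and z = ?z,
        OF _ _ has_derivative_exp_shift[of l 0, simplified]] by simp
    have "\<bar>u (t - h) x - \<phi> (x + c * (t - h))\<bar> \<le> C * exp (- \<gamma> * (t - h)) * exp (l * (?z - c * h))"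
      using past history[of "t - h" x] t by (cases "h \<le> t") (auto simp: algebra_simps)
    then have "\<bar>g (u (t - h) x) - g (\<phi> (x + c * (t - h)))\<bar> \<le> C * exp (- \<gamma> * t) *
        (c * (l * exp (l * ?z)) - l * (l * exp (l * ?z)) + (1 - \<gamma>) * exp (l * ?z))"
      by (intro order_trans[OF lipschitz_on_line[OF H]] exponential_residual) (use \<gamma> C L in auto)
    with jet show "\<exists>a b. superjet (\<lambda>z. exp (l * z)) ?z a b \<and>
         \<bar>g (u (t - h) x) - g (\<phi> (x + c * (t - h)))\<bar>
           \<le> C * exp (- \<gamma> * t) * (c * a - b + (1 - \<gamma>) * exp (l * ?z))" by blast
  qed (use C in \<open>auto intro!: continuous_intros\<close>)
  with C \<gamma>(1) show ?thesis by blast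
qed

section \<open>Contraction near the positive equilibrium\<close>

lemma lipschitz_of_deriv_le:
  fixes g :: "real \<Rightarrow> real"
  assumes "\<And>v. v \<in> {a..b} \<Longrightarrow> g differentiable (at v) \<and> \<bar>deriv g v\<bar> \<le> q"
    and "p \<in> {a..b}" "r \<in> {a..b}"
  shows "\<bar>g p - g r\<bar> \<le> q * \<bar>p - r\<bar>"
proof -
  have "norm (g p - g r) \<le> q * norm (p - r)"
  proof (rule field_differentiable_bound[where S = "{a..b}" and f' = "deriv g"])
    show "(g has_field_derivative deriv g z) (at z within {a..b})" if "z \<in> {a..b}" for z
      using assms(1)[OF that] DERIV_deriv_iff_real_differentiable has_field_derivative_at_within
      by blast
  qed (use assms in auto)
  then show ?thesis by simp
qed

lemma nonexpansive_of_deriv_less: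
  fixes g :: "real \<Rightarrow> real"
  assumes "\<forall>v\<in>{\<kappa>-\<rho>..\<kappa>+\<rho>}. g differentiable (at v) \<and> \<bar>deriv g v\<bar> < 1"
    and "\<bar>p - \<kappa>\<bar> \<le> \<rho>" "\<bar>r - \<kappa>\<bar> \<le> \<rho>"
  shows "\<bar>g p - g r\<bar> \<le> \<bar>p - r\<bar>"
proof -
  have "\<bar>g p - g r\<bar> \<le> 1 * \<bar>p - r\<bar>"
    by (rule lipschitz_of_deriv_le[of "\<kappa> - \<rho>" "\<kappa> + \<rho>"])
       (use assms in \<open>auto simp: abs_le_iff simp del: abs_le_iff intro: less_imp_le\<close>)
  then show ?thesis by simp
qed

text \<open>
  One state has to be close to \<open>\<kappa>\<close>, the other ranges over the whole interval.  If both are close,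
  continuity of \<open>g'\<close> at \<open>\<kappa>\<close> bounds the slope away from \<open>1\<close>.  Otherwise the segment between them
  crosses a piece of length at least \<open>e / 2\<close> on which the slope is bounded by \<open>q1 < 1\<close>; as the whole
  segment is no longer than \<open>2 * \<rho>\<close>, this gains a fixed fraction of its length.
\<close>

lemma contraction_near_kappa:
  assumes H: "hyp_H g \<kappa> L" and \<rho>: "\<rho> > 0"
    and slope: "\<forall>v\<in>{\<kappa>-\<rho>..\<kappa>+\<rho>}. g differentiable (at v) \<and> \<bar>deriv g v\<bar> < 1"
  obtains q d where "0 < q" "q < 1" "0 < d" "d \<le> \<rho>"
    "\<And>p r. \<bar>p - \<kappa>\<bar> \<le> d \<Longrightarrow> \<bar>r - \<kappa>\<bar> \<le> \<rho> \<Longrightarrow> \<bar>g p - g r\<bar> \<le> q * \<bar>p - r\<bar>"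
proof -
  have "\<exists>\<delta>>0. C1_on g {\<kappa>-\<delta>..\<kappa>+\<delta>}"
    using H unfolding hyp_H_def by (elim conjE exE) (intro exI conjI, assumption, assumption)
  then obtain \<delta> where "\<delta> > 0" "C1_on g {\<kappa>-\<delta>..\<kappa>+\<delta>}" by blast
  then have \<delta>: "\<delta> > 0" "continuous_on {\<kappa>-\<delta>..\<kappa>+\<delta>} (deriv g)"
    by (simp_all add: C1_on_def)
  have k1: "\<bar>deriv g \<kappa>\<bar> < 1" using slope \<rho> by simp
  define q1 where "q1 = (1 + \<bar>deriv g \<kappa>\<bar>) / 2"
  have q1: "0 < q1" "q1 < 1" "\<bar>deriv g \<kappa>\<bar> < q1" using k1 by (auto simp: q1_def)
  obtain d0 where d0: "d0 > 0" "\<And>v. v \<in> {\<kappa>-\<delta>..\<kappa>+\<delta>} \<Longrightarrow> dist v \<kappa> < d0 \<Longrightarrow>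
      dist (deriv g v) (deriv g \<kappa>) < q1 - \<bar>deriv g \<kappa>\<bar>"
    using \<delta>(2)[unfolded continuous_on_iff, rule_format, of \<kappa> "q1 - \<bar>deriv g \<kappa>\<bar>"] \<delta>(1) q1 by auto
  define e where "e = min (min \<delta> (d0 / 2)) \<rho>"
  have e: "e > 0" "e \<le> \<rho>" using \<delta> d0 \<rho> by (auto simp: e_def)
  have inner: "\<bar>g p - g r\<bar> \<le> q1 * \<bar>p - r\<bar>" if "\<bar>p - \<kappa>\<bar> \<le> e" "\<bar>r - \<kappa>\<bar> \<le> e" for p r
  proof (rule lipschitz_of_deriv_le[where a = "\<kappa> - e" and b = "\<kappa> + e"])
    fix v assume v: "v \<in> {\<kappa> - e..\<kappa> + e}"
    have "dist (deriv g v) (deriv g \<kappa>) < q1 - \<bar>deriv g \<kappa>\<bar>"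
      by (rule d0(2)) (use v d0(1) in \<open>auto simp: e_def dist_real_def min_def split: if_splits\<close>)
    then have "\<bar>deriv g v\<bar> \<le> q1" by (simp add: dist_real_def)
    moreover have "g differentiable (at v)" using slope v e by auto
    ultimately show "g differentiable (at v) \<and> \<bar>deriv g v\<bar> \<le> q1" by blast
  qed (use that in \<open>auto simp: abs_le_iff\<close>)
  note outer = nonexpansive_of_deriv_less[OF slope]
  define q2 where "q2 = 1 - (1 - q1) * e / (4 * \<rho>)"
  have "\<bar>g p - g r\<bar> \<le> max q1 q2 * \<bar>p - r\<bar>" if p: "\<bar>p - \<kappa>\<bar> \<le> e / 2" and r: "\<bar>r - \<kappa>\<bar> \<le> \<rho>" for p r
  proof (cases "\<bar>r - \<kappa>\<bar> \<le> e")
    case True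
    have "\<bar>g p - g r\<bar> \<le> q1 * \<bar>p - r\<bar>" by (rule inner) (use p True e in auto)
    also have "\<dots> \<le> max q1 q2 * \<bar>p - r\<bar>" by (intro mult_right_mono) auto
    finally show ?thesis .
  next
    case False
    \<comment> \<open>The point at which the segment from \<open>p\<close> to \<open>r\<close> leaves the inner interval.\<close>
    define k where "k = (if r > \<kappa> then \<kappa> + e else \<kappa> - e)"
    have split: "\<bar>p - r\<bar> = \<bar>p - k\<bar> + \<bar>k - r\<bar>" and pk: "e / 2 \<le> \<bar>p - k\<bar>" and pr: "\<bar>p - r\<bar> \<le> 2 * \<rho>"
      and k: "\<bar>k - \<kappa>\<bar> = e"
      using p r False e by (auto simp: k_def abs_if split: if_splits)
    have "\<bar>g p - g r\<bar> \<le> \<bar>g p - g k\<bar> + \<bar>g k - g r\<bar>" by simp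
    also have "\<dots> \<le> q1 * \<bar>p - k\<bar> + \<bar>k - r\<bar>"
      by (intro add_mono inner outer) (use p r k e in auto)
    also have "\<dots> = \<bar>p - r\<bar> - (1 - q1) * \<bar>p - k\<bar>" using split by (simp add: algebra_simps)
    also have "\<dots> \<le> \<bar>p - r\<bar> - (1 - q1) * (e / 2)"
      using pk q1 by (intro diff_left_mono mult_left_mono) auto
    also have "\<dots> \<le> \<bar>p - r\<bar> - (1 - q1) * e / (4 * \<rho>) * \<bar>p - r\<bar>"
    proof -
      have "(1 - q1) * e / (4 * \<rho>) * \<bar>p - r\<bar> \<le> (1 - q1) * e / (4 * \<rho>) * (2 * \<rho>)"
        using pr q1 e \<rho> by (intro mult_left_mono) auto
      also have "\<dots> = (1 - q1) * (e / 2)" using \<rho> by simp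
      finally show ?thesis by linarith
    qed
    also have "\<dots> = q2 * \<bar>p - r\<bar>" by (simp add: q2_def left_diff_distrib)
    also have "\<dots> \<le> max q1 q2 * \<bar>p - r\<bar>" by (intro mult_right_mono) auto
    finally show ?thesis .
  qed
  moreover have "max q1 q2 < 1" using q1 e \<rho> by (simp add: q2_def)
  ultimately show thesis using that[of "max q1 q2" "e / 2"] q1 e by auto
qed

section \<open>Convergence of the profile\<close>

text \<open>
  A bounded solution of \<open>y'' = c y' + y - F\<close> is asymptotically no larger than an upper bound of \<open>F\<close>:
  the excess decays like \<open>exp(-\<mu> z)\<close> for any \<open>\<mu> > 0\<close> with \<open>\<mu>\<^sup>2 + c \<mu> \<le> 1\<close>, and \<open>\<mu> = 1 / (1 + c)\<close> is such a rate.  The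
  linear penalty \<open>\<epsilon> * (x - Z)\<close> confines the maximum principle to a bounded interval.
\<close>

lemma half_line_barrier:
  fixes y :: "real \<Rightarrow> real"
  assumes c: "c > 0"
    and y': "\<And>z. (y has_real_derivative y' z) (at z)"
    and y'': "\<And>z. (y' has_real_derivative c * y' z + y z - F z) (at z)"
    and M: "\<And>z. z \<ge> Z \<Longrightarrow> y z \<le> M" "M \<ge> 0" and N: "\<And>z. z \<ge> Z \<Longrightarrow> F z \<le> N" "N \<ge> 0"
    and z: "z \<ge> Z"
  shows "y z \<le> N + M * exp (- (z - Z) / (1 + c))"
proof (rule ccontr)
  define \<mu> where "\<mu> = 1 / (1 + c)"
  have \<mu>: "0 < \<mu>" "\<mu> * (\<mu> + c) \<le> 1"
  proof -
    show pos: "0 < \<mu>" using c by (simp add: \<mu>_def)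
    have "\<mu> \<le> 1" using c by (simp add: \<mu>_def)
    then have "\<mu> * (\<mu> + c) \<le> \<mu> * (1 + c)" using pos by (intro mult_left_mono) auto
    then show "\<mu> * (\<mu> + c) \<le> 1" using c by (simp add: \<mu>_def)
  qed
  define B where "B = (\<lambda>x. N + M * exp (- \<mu> * (x - Z)))"
  assume "\<not> ?thesis"
  moreover have "- \<mu> * (z - Z) = - (z - Z) / (1 + c)" using c by (simp add: \<mu>_def field_simps)
  ultimately have bad: "y z > B z" unfolding B_def by (simp only: not_le)
  define \<epsilon> where "\<epsilon> = (y z - B z) / (2 * (z - Z + 1))"
  have \<epsilon>: "\<epsilon> > 0" using bad z by (simp add: \<epsilon>_def)
  define V where "V = (\<lambda>x. B x + \<epsilon> * (x - Z) - y x)"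
  have "\<epsilon> * (z - Z) \<le> \<epsilon> * (z - Z + 1)" using \<epsilon> by simp
  also have "\<dots> = (y z - B z) / 2" using z by (simp add: \<epsilon>_def field_simps)
  finally have Vz: "V z < 0" using bad by (simp add: V_def field_simps)
  define R where "R = max (z - Z) (M / \<epsilon>)"
  have R: "z \<le> Z + R" "M / \<epsilon> \<le> R" by (auto simp: R_def)
  then have MR: "M \<le> \<epsilon> * R" using \<epsilon> by (simp add: field_simps)
  have "continuous_on {Z..Z+R} V"
    unfolding V_def B_def
    by (intro continuous_intros continuous_at_imp_continuous_on ballI DERIV_isCont[OF y'])
  then obtain x where x: "x \<in> {Z..Z+R}" "\<And>x'. x' \<in> {Z..Z+R} \<Longrightarrow> V x \<le> V x'"
    using continuous_attains_inf[of "{Z..Z+R}" V] z R by auto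
  have Vx: "V x < 0" using x(2)[of z] Vz z R by auto
  have "V Z \<ge> 0" using M(1)[of Z] N(2) by (simp add: V_def B_def)
  then have xZ: "x > Z" using Vx x(1) by (cases "x = Z") auto
  have "V (Z + R) \<ge> 0"
  proof -
    have "B (Z + R) \<ge> 0" using M N by (simp add: B_def)
    moreover have "y (Z + R) \<le> M" using M(1) x(1) by auto
    ultimately show ?thesis using MR by (simp add: V_def)
  qed
  then have xR: "x < Z + R" using Vx x(1) by (cases "x = Z + R") auto
  define E where "E = (\<lambda>x. M * exp (- \<mu> * (x - Z)))"
  define V' where "V' = (\<lambda>x. - \<mu> * E x + \<epsilon> - y' x)"
  have dV: "(V has_real_derivative V' s) (at s)" for s
    unfolding V_def V'_def B_def E_def using y' by (auto intro!: derivative_eq_intros)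
  have dV': "(V' has_real_derivative \<mu> * \<mu> * E x - (c * y' x + y x - F x)) (at x)"
    unfolding V'_def E_def using y'' by (auto intro!: derivative_eq_intros)
  have e: "min (x - Z) (Z + R - x) > 0" using xZ xR by simp
  have loc: "V x \<le> V s" if "\<bar>x - s\<bar> < min (x - Z) (Z + R - x)" for s
    using x(2)[of s] that by (auto simp: abs_if split: if_splits)
  have "V' x = 0" "\<mu> * \<mu> * E x - (c * y' x + y x - F x) \<ge> 0"
    using second_derivative_nonneg_at_local_min[OF dV dV' e loc] by blast+
  then have "0 \<le> \<mu> * \<mu> * E x - (c * (- \<mu> * E x + \<epsilon>) + y x - F x)" by (simp add: V'_def)
  also have "\<dots> = (\<mu> * (\<mu> + c) - 1) * E x + (F x - N) - c * \<epsilon> - \<epsilon> * (x - Z) + V x"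
    by (simp add: V_def B_def E_def algebra_simps)
  also have "\<dots> < 0"
  proof -
    have "(\<mu> * (\<mu> + c) - 1) * E x \<le> 0"
      using \<mu> M by (intro mult_nonpos_nonneg) (auto simp: E_def)
    moreover have "F x \<le> N" using N x by auto
    moreover have "c * \<epsilon> > 0" "\<epsilon> * (x - Z) > 0" using c \<epsilon> xZ by auto
    ultimately show ?thesis using Vx by linarith
  qed
  finally show False by simp
qed

text \<open>
  If \<open>\<bar>\<phi> - \<kappa>\<bar> \<le> s\<close> eventually, then \<open>g \<circ> \<phi>\<close> is eventually within \<open>q s\<close> of \<open>\<kappa>\<close>, and the barrier transfers
  this to \<open>\<phi>\<close> up to a vanishing term.  So the eventual deviation can be multiplied by
  \<open>(1 + q) / 2 < 1\<close> again and again.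
\<close>

lemma profile_tendsto_equilibrium:
  assumes c: "c > 0" and h: "h > 0" and wave: "semi_wavefront g h c \<phi>"
    and q: "0 \<le> q" "q < 1" and g: "\<And>v. \<bar>v - \<kappa>\<bar> \<le> r \<Longrightarrow> \<bar>g v - \<kappa>\<bar> \<le> q * \<bar>v - \<kappa>\<bar>"
    and near: "\<And>z. z \<ge> Z \<Longrightarrow> \<bar>\<phi> z - \<kappa>\<bar> \<le> r"
  shows "(\<phi> \<longlongrightarrow> \<kappa>) at_top"
proof -
  obtain \<phi>' \<phi>'' where d: "\<And>z. (\<phi> has_real_derivative \<phi>' z) (at z)"
    "\<And>z. (\<phi>' has_real_derivative \<phi>'' z) (at z)"
    "\<And>z. \<phi>'' z = c * \<phi>' z + \<phi> z - g (\<phi> (z - c * h))"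
    using semi_wavefront_ode[OF wave] by blast
  have r: "r \<ge> 0" using near[of Z] by simp
  define \<theta> where "\<theta> = (1 + q) / 2"
  have \<theta>: "0 < \<theta>" "\<theta> < 1" "q < \<theta>" using q by (auto simp: \<theta>_def)
  have "\<exists>Z. \<forall>z\<ge>Z. \<bar>\<phi> z - \<kappa>\<bar> \<le> \<theta> ^ n * r" for n
  proof (induction n)
    case 0
    then show ?case using near by auto
  next
    case (Suc n)
    define s where "s = \<theta> ^ n * r"
    have s: "0 \<le> s" "s \<le> r" using \<theta> r by (auto simp: s_def mult_left_le_one_le power_le_one)
    from Suc obtain Z1 where Z1: "\<And>z. z \<ge> Z1 \<Longrightarrow> \<bar>\<phi> z - \<kappa>\<bar> \<le> s" unfolding s_def by blast
    define Z2 where "Z2 = Z1 + c * h"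
    have ge: "Z2 \<ge> Z1" using c h by (simp add: Z2_def)
    have G: "\<bar>g (\<phi> (z - c * h)) - \<kappa>\<bar> \<le> q * s" if "z \<ge> Z2" for z
    proof -
      have a: "\<bar>\<phi> (z - c * h) - \<kappa>\<bar> \<le> s" using Z1 that by (simp add: Z2_def)
      have "\<bar>g (\<phi> (z - c * h)) - \<kappa>\<bar> \<le> q * \<bar>\<phi> (z - c * h) - \<kappa>\<bar>" by (rule g) (use a s in simp)
      also have "\<dots> \<le> q * s" using a q by (intro mult_left_mono) auto
      finally show ?thesis .
    qed
    have up: "\<phi> z - \<kappa> \<le> q * s + s * exp (- (z - Z2) / (1 + c))" if "z \<ge> Z2" for z
    proof (rule half_line_barrier[OF c, where y' = \<phi>' and F = "\<lambda>z. g (\<phi> (z - c * h)) - \<kappa>"])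
      show "((\<lambda>z. \<phi> z - \<kappa>) has_real_derivative \<phi>' z) (at z)" for z
        using d(1) by (auto intro!: derivative_eq_intros)
      show "(\<phi>' has_real_derivative c * \<phi>' z + (\<phi> z - \<kappa>) - (g (\<phi> (z - c * h)) - \<kappa>)) (at z)" for z
        using d(2)[of z] by (simp add: d(3) algebra_simps)
      show "\<phi> z - \<kappa> \<le> s" if "Z2 \<le> z" for z using Z1[of z] ge that by simp
      show "g (\<phi> (z - c * h)) - \<kappa> \<le> q * s" if "Z2 \<le> z" for z using G[OF that] by simp
    qed (use s q that in auto)
    have low: "- (\<phi> z - \<kappa>) \<le> q * s + s * exp (- (z - Z2) / (1 + c))" if "z \<ge> Z2" for z
    proof (rule half_line_barrier[OF c, where y' = "\<lambda>z. - \<phi>' z" and F = "\<lambda>z. - (g (\<phi> (z - c * h)) - \<kappa>)"])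
      show "((\<lambda>z. - (\<phi> z - \<kappa>)) has_real_derivative - \<phi>' z) (at z)" for z
        using d(1) by (auto intro!: derivative_eq_intros)
      show "((\<lambda>z. - \<phi>' z) has_real_derivative
          c * - \<phi>' z + - (\<phi> z - \<kappa>) - - (g (\<phi> (z - c * h)) - \<kappa>)) (at z)" for z
        using DERIV_minus[OF d(2)[of z]] by (simp add: d(3) algebra_simps)
      show "- (\<phi> z - \<kappa>) \<le> s" if "Z2 \<le> z" for z using Z1[of z] ge that by simp
      show "- (g (\<phi> (z - c * h)) - \<kappa>) \<le> q * s" if "Z2 \<le> z" for z using G[OF that] by simp
    qed (use s q that in auto)
    define Z3 where "Z3 = Z2 + (1 + c) * (1 - ln (\<theta> - q))"
    have Z3: "exp (- (z - Z2) / (1 + c)) < \<theta> - q" if "z \<ge> Z3" for z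
    proof -
      have "(1 + c) * (1 - ln (\<theta> - q)) \<le> z - Z2" using that by (simp add: Z3_def)
      then have "1 - ln (\<theta> - q) \<le> (z - Z2) / (1 + c)"
        using c by (simp add: pos_le_divide_eq mult.commute)
      then have "- (z - Z2) / (1 + c) < ln (\<theta> - q)" unfolding minus_divide_left[symmetric] by linarith
      then have "exp (- (z - Z2) / (1 + c)) < exp (ln (\<theta> - q))" by (simp only: exp_less_mono)
      then show ?thesis using \<theta> by simp
    qed
    have "\<bar>\<phi> z - \<kappa>\<bar> \<le> \<theta> ^ Suc n * r" if "z \<ge> max Z2 Z3" for z
    proof -
      have "s * exp (- (z - Z2) / (1 + c)) \<le> s * (\<theta> - q)"
        using Z3[of z] that s by (intro mult_left_mono) auto
      then have "\<bar>\<phi> z - \<kappa>\<bar> \<le> \<theta> * s" using up[of z] low[of z] that by (simp add: algebra_simps abs_le_iff)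
      then show ?thesis by (simp add: s_def)
    qed
    then show ?case by blast
  qed
  note shrink = this
  have "eventually (\<lambda>z. dist (\<phi> z) \<kappa> < e) at_top" if "e > 0" for e
  proof -
    have "(\<lambda>n. \<theta> ^ n * r) \<longlonglongrightarrow> 0 * r"
      by (intro tendsto_mult_right LIMSEQ_realpow_zero) (use \<theta> in auto)
    then have "eventually (\<lambda>n. \<theta> ^ n * r < e) sequentially"
      by (intro order_tendstoD(2)[where y = 0]) (use that in auto)
    then obtain n where "\<theta> ^ n * r < e" by (auto dest: eventually_happens)
    with shrink[of n] show ?thesis
      unfolding eventually_at_top_linorder dist_real_def by (meson le_less_trans)
  qed
  then show ?thesis by (rule tendstoI)
qed


section \<open>Local stability\<close>

text \<open>
  A logistic transition from \<open>1 - \<epsilon>\<close> at \<open>-\<infinity>\<close> to \<open>1\<close> at \<open>+\<infinity>\<close>.  The rate \<open>c\<close> in the exponent equals the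
  drift in the moving frame, which makes \<open>c m' - m''\<close> positive for \<open>m = ramp \<epsilon> c\<close>
  (\<open>ramp_dissipation\<close>).
\<close>

definition ramp :: "real \<Rightarrow> real \<Rightarrow> real \<Rightarrow> real" where
  "ramp \<epsilon> c y = 1 - \<epsilon> / (1 + exp (c * y))"

lemma ramp_bounds:
  assumes "0 \<le> \<epsilon>"
  shows "1 - \<epsilon> \<le> ramp \<epsilon> c y" "ramp \<epsilon> c y \<le> 1"
proof -
  have "\<epsilon> / (1 + exp (c * y)) \<le> \<epsilon> / 1"
    using assms by (intro divide_left_mono) (auto simp: add_pos_pos)
  then show "1 - \<epsilon> \<le> ramp \<epsilon> c y" by (simp add: ramp_def)
  show "ramp \<epsilon> c y \<le> 1" using assms by (simp add: ramp_def add_pos_pos)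
qed

lemma ramp_mono:
  assumes "0 \<le> \<epsilon>" "0 \<le> c" "x \<le> y"
  shows "ramp \<epsilon> c x \<le> ramp \<epsilon> c y"
  unfolding ramp_def using assms
  by (intro diff_left_mono divide_left_mono) (auto simp: add_pos_pos mult_left_mono)

definition ramp' :: "real \<Rightarrow> real \<Rightarrow> real \<Rightarrow> real" where
  "ramp' \<epsilon> c y = \<epsilon> * c * exp (c * y) / (1 + exp (c * y))\<^sup>2"

definition ramp'' :: "real \<Rightarrow> real \<Rightarrow> real \<Rightarrow> real" where
  "ramp'' \<epsilon> c y = \<epsilon> * c\<^sup>2 * exp (c * y) * (1 - exp (c * y)) / (1 + exp (c * y)) ^ 3"

lemma ramp_derivatives:
  "((\<lambda>z. ramp \<epsilon> c (z - b)) has_real_derivative ramp' \<epsilon> c (z - b)) (at z)"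
  "((\<lambda>z. ramp' \<epsilon> c (z - b)) has_real_derivative ramp'' \<epsilon> c (z - b)) (at z)"
proof -
  have pos: "1 + exp (c * (z - b)) \<noteq> 0" by (smt (verit) exp_gt_zero)
  show "((\<lambda>z. ramp \<epsilon> c (z - b)) has_real_derivative ramp' \<epsilon> c (z - b)) (at z)"
    unfolding ramp_def ramp'_def
    by (rule derivative_eq_intros refl pos)+ (use pos in \<open>simp add: power2_eq_square\<close>)
  define E where "E = exp (c * (z - b))"
  have E: "1 + E \<noteq> 0" using pos by (simp add: E_def)
  have "((\<lambda>z. \<epsilon> * c * exp (c * (z - b)) / (1 + exp (c * (z - b)))\<^sup>2) has_real_derivative
      (\<epsilon> * c * (E * c) * (1 + E)\<^sup>2 - \<epsilon> * c * E * (2 * (1 + E) * (E * c))) / ((1 + E)\<^sup>2 * (1 + E)\<^sup>2)) (at z)"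
    unfolding E_def
    by (rule derivative_eq_intros refl)+ (use pos in \<open>auto simp: algebra_simps\<close>)
  also have "(\<epsilon> * c * (E * c) * (1 + E)\<^sup>2 - \<epsilon> * c * E * (2 * (1 + E) * (E * c))) / ((1 + E)\<^sup>2 * (1 + E)\<^sup>2)
      = \<epsilon> * c\<^sup>2 * E * (1 - E) / (1 + E) ^ 3"
  proof -
    have "\<epsilon> * c * (E * c) * (1 + E)\<^sup>2 - \<epsilon> * c * E * (2 * (1 + E) * (E * c))
        = (\<epsilon> * c\<^sup>2 * E * (1 - E)) * (1 + E)"
      by (simp add: power2_eq_square algebra_simps)
    moreover have "(1 + E)\<^sup>2 * (1 + E)\<^sup>2 = (1 + E) ^ 3 * (1 + E)"
      by (simp add: power2_eq_square power3_eq_cube)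
    ultimately show ?thesis using E by simp
  qed
  finally show "((\<lambda>z. ramp' \<epsilon> c (z - b)) has_real_derivative ramp'' \<epsilon> c (z - b)) (at z)"
    unfolding ramp'_def ramp''_def E_def .
qed

lemma ramp_dissipation:
  "c * ramp' \<epsilon> c y - ramp'' \<epsilon> c y = 2 * \<epsilon> * c\<^sup>2 * (exp (c * y))\<^sup>2 / (1 + exp (c * y)) ^ 3"
proof -
  define E where "E = exp (c * y)"
  have E: "1 + E \<noteq> 0" unfolding E_def by (smt (verit) exp_gt_zero)
  have "c * (\<epsilon> * c * E / (1 + E)\<^sup>2) = \<epsilon> * c\<^sup>2 * E * (1 + E) / ((1 + E)\<^sup>2 * (1 + E))"
    using E by (simp add: power2_eq_square)
  also have "(1 + E)\<^sup>2 * (1 + E) = (1 + E) ^ 3" by (simp add: power2_eq_square power3_eq_cube)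
  finally have "c * (\<epsilon> * c * E / (1 + E)\<^sup>2) - \<epsilon> * c\<^sup>2 * E * (1 - E) / (1 + E) ^ 3
      = (\<epsilon> * c\<^sup>2 * E * (1 + E) - \<epsilon> * c\<^sup>2 * E * (1 - E)) / (1 + E) ^ 3"
    by (simp add: diff_divide_distrib)
  also have "\<epsilon> * c\<^sup>2 * E * (1 + E) - \<epsilon> * c\<^sup>2 * E * (1 - E) = 2 * \<epsilon> * c\<^sup>2 * E\<^sup>2"
    by (simp add: power2_eq_square algebra_simps)
  finally show ?thesis unfolding ramp'_def ramp''_def E_def .
qed

lemma ramp_dissipation_nonneg:
  assumes "0 \<le> \<epsilon>"
  shows "0 \<le> c * ramp' \<epsilon> c y - ramp'' \<epsilon> c y"
  unfolding ramp_dissipation using assms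
  by (intro divide_nonneg_nonneg mult_nonneg_nonneg) (auto intro: add_nonneg_nonneg)

lemma ramp_dissipation_lower_bound:
  assumes "0 \<le> \<epsilon>" "0 \<le> c" "a \<le> y" "y \<le> b"
  shows "2 * \<epsilon> * c\<^sup>2 * (exp (c * a))\<^sup>2 / (1 + exp (c * b)) ^ 3 \<le> c * ramp' \<epsilon> c y - ramp'' \<epsilon> c y"
  unfolding ramp_dissipation using assms
  by (intro frac_le mult_left_mono power_mono) (auto simp: mult_left_mono intro: add_nonneg_nonneg add_pos_pos)

text \<open>
  The supersolution inequality for the ramp.  Monotonicity replaces the delayed value by the present
  one, so it remains to beat \<open>a exp(\<gamma> h) + \<gamma> - 1\<close>: by the dissipation if \<open>a = 1\<close>, and by \<open>1 - a\<close>
  alone if \<open>a < 1\<close>.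
\<close>

lemma ramp_residual:
  assumes \<epsilon>: "0 \<le> \<epsilon>" "\<epsilon> \<le> 1" and "0 \<le> c" "0 \<le> h" "0 \<le> K" and a: "0 \<le> a" and \<gamma>: "0 \<le> \<gamma>"
    and rate: "\<gamma> + a * exp (\<gamma> * h) \<le> 1 + (c * ramp' \<epsilon> c y - ramp'' \<epsilon> c y)"
    and D: "D \<le> K * exp (- \<gamma> * (t - h)) * ramp \<epsilon> c (y - c * h)"
  shows "a * D \<le> K * exp (- \<gamma> * t) * (c * ramp' \<epsilon> c y - ramp'' \<epsilon> c y + (1 - \<gamma>) * ramp \<epsilon> c y)"
proof -
  let ?\<psi> = "ramp \<epsilon> c y" and ?\<delta> = "c * ramp' \<epsilon> c y - ramp'' \<epsilon> c y"
  have \<psi>: "0 \<le> ?\<psi>" "?\<psi> \<le> 1" using ramp_bounds[OF \<epsilon>(1), of c y] \<epsilon> by auto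
  have le: "ramp \<epsilon> c (y - c * h) \<le> ?\<psi>" using assms by (intro ramp_mono) auto
  have "a * D \<le> a * (K * exp (- \<gamma> * (t - h)) * ?\<psi>)"
    using D le a \<open>0 \<le> K\<close> by (intro mult_left_mono order_trans[OF D]) auto
  also have "\<dots> = K * exp (- \<gamma> * t) * (a * exp (\<gamma> * h) * ?\<psi>)"
    by (simp add: algebra_simps flip: exp_add)
  also have "\<dots> \<le> K * exp (- \<gamma> * t) * (?\<delta> + (1 - \<gamma>) * ?\<psi>)"
  proof (intro mult_left_mono)
    have "(a * exp (\<gamma> * h) + \<gamma> - 1) * ?\<psi> \<le> ?\<delta> * ?\<psi>" using rate \<psi> by (intro mult_right_mono) auto
    also have "\<dots> \<le> ?\<delta> * 1"
      using ramp_dissipation_nonneg[OF \<epsilon>(1)] \<psi> by (intro mult_left_mono) auto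
    finally show "a * exp (\<gamma> * h) * ?\<psi> \<le> ?\<delta> + (1 - \<gamma>) * ?\<psi>" by (simp add: algebra_simps)
  qed (use \<open>0 \<le> K\<close> in auto)
  finally show ?thesis .
qed

text \<open>
  Both functions lie in \<open>[\<kappa> - \<rho>/4, \<kappa> + \<rho>/4)\<close>, so their distance is less than \<open>\<rho>/2\<close> at each point.
  On bounded ranges of \<open>x\<close> compactness makes this uniform; for large \<open>x\<close> the profile is within
  \<open>\<rho>/8\<close> of \<open>\<kappa>\<close>, so the distance is at most \<open>3\<rho>/8\<close>.
\<close>

lemma strict_initial_gap:
  assumes h: "h > 0" and \<rho>: "\<rho> > 0" and w: "initial_function h w\<^sub>0"
    and wave: "semi_wavefront g h c \<phi>" and lim: "(\<phi> \<longlongrightarrow> \<kappa>) at_top" and c: "c > 0"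
    and near: "\<And>x s. x \<ge> b \<Longrightarrow> s \<in> {-h..0} \<Longrightarrow> \<kappa> - \<rho> / 4 \<le> w\<^sub>0 s x \<and> w\<^sub>0 s x < \<kappa> + \<rho> / 4 \<and>
          \<kappa> - \<rho> / 4 \<le> \<phi> (x + c * s) \<and> \<phi> (x + c * s) < \<kappa> + \<rho> / 4"
  obtains \<epsilon> where "0 < \<epsilon>" "\<epsilon> < 1"
    "\<And>x s. x \<ge> b \<Longrightarrow> s \<in> {-h..0} \<Longrightarrow> \<bar>w\<^sub>0 s x - \<phi> (x + c * s)\<bar> \<le> \<rho> / 2 * (1 - \<epsilon>)"
proof -
  have "eventually (\<lambda>z. dist (\<phi> z) \<kappa> < \<rho> / 8) at_top" using lim \<rho> by (intro tendstoD) auto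
  then obtain X1 where X1: "\<And>z. z \<ge> X1 \<Longrightarrow> \<bar>\<phi> z - \<kappa>\<bar> < \<rho> / 8"
    unfolding eventually_at_top_linorder dist_real_def by blast
  define X where "X = max b (X1 + c * h)"
  define f where "f = (\<lambda>k. \<bar>w\<^sub>0 (fst k) (snd k) - \<phi> (snd k + c * fst k)\<bar>)"
  have "continuous_on ({-h..0} \<times> UNIV) (\<lambda>k. w\<^sub>0 (fst k) (snd k))"
    using w by (simp add: initial_function_def case_prod_unfold)
  then have 1: "continuous_on ({-h..0} \<times> {b..X}) (\<lambda>k. w\<^sub>0 (fst k) (snd k))"
    by (rule continuous_on_subset) auto
  have "continuous_on ({-h..0} \<times> {b..X}) f"
    unfolding f_def
    by (intro continuous_intros 1 continuous_on_compose2[OF semi_wavefront_continuous[OF wave, of UNIV]])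
       auto
  moreover have "{-h..0} \<times> {b..X} \<noteq> {}" using h by (auto simp: X_def)
  ultimately obtain k where k: "k \<in> {-h..0} \<times> {b..X}" "\<And>k'. k' \<in> {-h..0} \<times> {b..X} \<Longrightarrow> f k' \<le> f k"
    using continuous_attains_sup[OF compact_Times[OF compact_Icc compact_Icc], of "- h" 0 b X f] by blast
  have fk: "f k < \<rho> / 2"
  proof -
    have "snd k \<ge> b" "fst k \<in> {-h..0}" using k(1) by auto
    from near[OF this] show ?thesis unfolding f_def by linarith
  qed
  have fk0: "0 \<le> f k" by (simp add: f_def)
  define \<epsilon> where "\<epsilon> = min (1 / 4) (1 - f k / (\<rho> / 2))"
  have "0 < \<epsilon>" "\<epsilon> < 1" using fk \<rho> by (auto simp: \<epsilon>_def field_simps)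
  moreover have "\<bar>w\<^sub>0 s x - \<phi> (x + c * s)\<bar> \<le> \<rho> / 2 * (1 - \<epsilon>)" if x: "x \<ge> b" and s: "s \<in> {-h..0}" for x s
  proof (cases "x \<le> X")
    case True
    have "f (s, x) \<le> f k" by (rule k(2)) (use x s True in auto)
    also have "f k = \<rho> / 2 * (f k / (\<rho> / 2))" using \<rho> by simp
    also have "\<dots> \<le> \<rho> / 2 * (1 - \<epsilon>)"
      using \<rho> unfolding \<epsilon>_def by (intro mult_left_mono) auto
    finally show ?thesis by (simp add: f_def)
  next
    case False
    have "c * (h + s) \<ge> 0" using c s by simp
    then have "x + c * s \<ge> X1" using False by (simp add: X_def algebra_simps)
    then have "\<bar>w\<^sub>0 s x - \<phi> (x + c * s)\<bar> \<le> \<rho> / 4 + \<rho> / 8"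
      using X1[of "x + c * s"] near[OF x s] by linarith
    also have "\<dots> = \<rho> / 2 * (1 - 1 / 4)" by simp
    also have "\<dots> \<le> \<rho> / 2 * (1 - \<epsilon>)"
    proof (intro mult_left_mono)
      show "1 - 1 / 4 \<le> 1 - \<epsilon>" unfolding \<epsilon>_def by linarith
    qed (use \<rho> in simp)
    finally show ?thesis .
  qed
  ultimately show thesis by (rule that)
qed

text \<open>
  The supersolution is \<open>\<rho>/2 exp(-\<gamma> t) m(z)\<close> with \<open>m(z) = min (exp(l y)) (ramp \<epsilon> c y)\<close>, \<open>y = z - b\<close>.
  Where the exponential is the smaller branch, \<open>y \<le> 0\<close> and the Lipschitz bound \<open>g'(0)\<close> suffices.
  Where the ramp is the smaller branch, \<open>y \<ge> -ch\<close>, since \<open>\<epsilon>\<close> is chosen with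
  \<open>exp(-lch) \<le> 1 - \<epsilon>\<close>; then the delayed argument is at least \<open>b - 2ch\<close>, the range on which the
  hypotheses keep \<open>\<phi>\<close> within \<open>\<rho>/4\<close> of \<open>\<kappa>\<close>.  There \<open>g\<close> is nonexpansive, and for \<open>y \<ge> Y\<close> it contracts by
  \<open>q\<close>.
\<close>

lemma local_stability:
  assumes h: "h > 0" and H: "hyp_H g \<kappa> (deriv g 0)" and c: "c > 0"
    and l: "l > 0" and chi: "chi0 g h c l < 0"
    and wave: "semi_wavefront g h c \<phi>" and sol: "is_solution g h w\<^sub>0 u"
    and w: "initial_function h w\<^sub>0" and \<rho>: "\<rho> > 0"
    and slope: "\<forall>v\<in>{\<kappa>-\<rho>..\<kappa>+\<rho>}. g differentiable (at v) \<and> \<bar>deriv g v\<bar> < 1"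
    and near: "\<And>x s. x \<ge> b - c * h \<Longrightarrow> s \<in> {-h..0} \<Longrightarrow>
          \<kappa> - \<rho> / 4 \<le> w\<^sub>0 s x \<and> w\<^sub>0 s x < \<kappa> + \<rho> / 4 \<and>
          \<kappa> - \<rho> / 4 \<le> \<phi> (x + c * s) \<and> \<phi> (x + c * s) < \<kappa> + \<rho> / 4"
    and far: "\<And>x s. x \<le> b \<Longrightarrow> s \<in> {-h..0} \<Longrightarrow>
          \<bar>w\<^sub>0 s x - \<phi> (x + c * s)\<bar> \<le> \<rho> / 2 * exp (l * (x + c * s - b))"
  shows "(\<phi> \<longlongrightarrow> \<kappa>) at_top"
    and "\<exists>\<gamma>>0. \<forall>t\<ge>0. \<forall>x. \<bar>u t x - \<phi> (x + c * t)\<bar>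
           \<le> \<rho> / 2 * exp (- \<gamma> * t) * min (exp (l * (x + c * t - b))) 1"
proof -
  have L: "deriv g 0 > 1" and fixed: "g \<kappa> = \<kappa>" using H unfolding hyp_H_def by blast+
  obtain q d where q: "0 < q" "q < 1" and d: "0 < d" "d \<le> \<rho>"
    and contr: "\<And>p r. \<bar>p - \<kappa>\<bar> \<le> d \<Longrightarrow> \<bar>r - \<kappa>\<bar> \<le> \<rho> \<Longrightarrow> \<bar>g p - g r\<bar> \<le> q * \<bar>p - r\<bar>"
    using contraction_near_kappa[OF H \<rho> slope] by blast
  have \<phi>_near: "\<bar>\<phi> z - \<kappa>\<bar> \<le> \<rho> / 4" if "z \<ge> b - 2 * c * h" for z
  proof -
    have "z + c * h \<ge> b - c * h" "- h \<in> {-h..0}" using that h by auto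
    from near[OF this] have "\<kappa> - \<rho> / 4 \<le> \<phi> z" "\<phi> z < \<kappa> + \<rho> / 4" by auto
    then show ?thesis by linarith
  qed
  show lim: "(\<phi> \<longlongrightarrow> \<kappa>) at_top"
  proof (rule profile_tendsto_equilibrium[OF c h wave _ q(2), where r = \<rho>])
    show "\<bar>g v - \<kappa>\<bar> \<le> q * \<bar>v - \<kappa>\<bar>" if "\<bar>v - \<kappa>\<bar> \<le> \<rho>" for v
      using contr[of \<kappa> v] d fixed that by (simp add: abs_minus_commute)
    show "\<bar>\<phi> z - \<kappa>\<bar> \<le> \<rho>" if "z \<ge> b - 2 * c * h" for z using \<phi>_near[OF that] \<rho> by simp
  qed (use q in simp)
  obtain \<epsilon>0 where \<epsilon>0: "0 < \<epsilon>0" "\<epsilon>0 < 1"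
    "\<And>x s. x \<ge> b - c * h \<Longrightarrow> s \<in> {-h..0} \<Longrightarrow> \<bar>w\<^sub>0 s x - \<phi> (x + c * s)\<bar> \<le> \<rho> / 2 * (1 - \<epsilon>0)"
    using strict_initial_gap[OF h \<rho> w wave lim c near] by blast
  have lch: "l * (c * h) > 0" using l c h by simp
  define \<epsilon> where "\<epsilon> = min \<epsilon>0 (1 - exp (- (l * (c * h))))"
  have \<epsilon>: "0 < \<epsilon>" "\<epsilon> < 1" "\<epsilon> \<le> \<epsilon>0" "exp (- (l * (c * h))) \<le> 1 - \<epsilon>"
    using \<epsilon>0 lch by (auto simp: \<epsilon>_def)
  have hist_far: "\<bar>u s x - \<phi> (x + c * s)\<bar> \<le> \<rho> / 2 * exp (l * (x + c * s - b))"
    if "x \<le> b" "s \<in> {-h..0}" for x s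
    using far[OF that] sol that by (simp add: is_solution_def)
  \<comment> \<open>To the left of \<open>b - c * h\<close> the exponential bound has already dropped below \<open>1 - \<epsilon>\<close>.\<close>
  have hist: "\<bar>u s x - \<phi> (x + c * s)\<bar> \<le> \<rho> / 2 * (1 - \<epsilon>)" if s: "s \<in> {-h..0}" for s x
  proof (cases "x \<ge> b - c * h")
    case True
    have "\<bar>u s x - \<phi> (x + c * s)\<bar> \<le> \<rho> / 2 * (1 - \<epsilon>0)"
      using \<epsilon>0(3)[OF True s] sol s by (simp add: is_solution_def)
    also have "\<dots> \<le> \<rho> / 2 * (1 - \<epsilon>)" using \<epsilon> \<rho> by (intro mult_left_mono) auto
    finally show ?thesis .
  next
    case False
    have cs: "c * s \<le> 0" using c s by (simp add: mult_nonneg_nonpos)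
    have "x \<le> b" using False c h by (smt (verit) mult_pos_pos)
    then have "\<bar>u s x - \<phi> (x + c * s)\<bar> \<le> \<rho> / 2 * exp (l * (x + c * s - b))" by (rule hist_far[OF _ s])
    also have "\<dots> \<le> \<rho> / 2 * (1 - \<epsilon>)"
    proof (intro mult_left_mono)
      have "l * (x + c * s - b) \<le> l * (- (c * h))" using l cs False by (intro mult_left_mono) auto
      then have "exp (l * (x + c * s - b)) \<le> exp (- (l * (c * h)))" by simp
      then show "exp (l * (x + c * s - b)) \<le> 1 - \<epsilon>" using \<epsilon>(4) by (rule order_trans)
    qed (use \<rho> in simp)
    finally show ?thesis .
  qed
  have "eventually (\<lambda>z. dist (\<phi> z) \<kappa> < d) at_top" using lim d by (intro tendstoD) auto
  then obtain Z where Z: "\<And>z. z \<ge> Z \<Longrightarrow> \<bar>\<phi> z - \<kappa>\<bar> < d"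
    unfolding eventually_at_top_linorder dist_real_def by blast
  define Y where "Y = Z + c * h - b"
  \<comment> \<open>A lower bound for the dissipation of the ramp on \<open>[- (c * h), Y]\<close>.\<close>
  define r where "r = 2 * \<epsilon> * c\<^sup>2 * (exp (c * - (c * h)))\<^sup>2 / (1 + exp (c * Y)) ^ 3"
  have r: "r > 0" unfolding r_def using \<epsilon> c by (auto intro!: divide_pos_pos add_pos_pos)
  obtain \<gamma> where \<gamma>: "\<gamma> > 0"
    and \<gamma>r: "\<gamma> + deriv g 0 * (exp (\<gamma> * h) - 1) < min (- chi0 g h c l) (min r (1 - q))"
    using ex_small_rate[of "min (- chi0 g h c l) (min r (1 - q))" "deriv g 0" h] chi r q by auto
  have e1: "exp (\<gamma> * h) \<ge> 1" using \<gamma> h by simp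
  \<comment> \<open>One smallness condition on \<open>\<gamma>\<close> serves the three regions, because \<open>1\<close>, \<open>q\<close> and
      \<open>g'(0) exp(-lch)\<close> are all at most \<open>g'(0)\<close>.\<close>
  have smaller: "\<gamma> + k * (exp (\<gamma> * h) - 1) < min (- chi0 g h c l) (min r (1 - q))" if "k \<le> deriv g 0" for k
  proof -
    have "k * (exp (\<gamma> * h) - 1) \<le> deriv g 0 * (exp (\<gamma> * h) - 1)"
      using e1 that by (intro mult_right_mono) auto
    then show ?thesis using \<gamma>r by linarith
  qed
  have rate_exp: "\<gamma> + deriv g 0 * exp (- l * c * h) * (exp (\<gamma> * h) - 1) \<le> - chi0 g h c l"
  proof -
    have "deriv g 0 * exp (- l * c * h) \<le> deriv g 0 * 1"
      using L lch by (intro mult_left_mono) (auto simp: mult_ac)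
    then show ?thesis using smaller[of "deriv g 0 * exp (- l * c * h)"] by simp
  qed
  have rate_mid: "\<gamma> + 1 * exp (\<gamma> * h) \<le> 1 + r" using smaller[of 1] L by simp
  have rate_q: "\<gamma> + q * exp (\<gamma> * h) \<le> 1" using smaller[of q] L q by (simp add: algebra_simps)
  define m where "m = (\<lambda>z. min (exp (l * (z - b))) (ramp \<epsilon> c (z - b)))"
  have m0: "m z \<ge> 0" for z using ramp_bounds[of \<epsilon> c "z - b"] \<epsilon> by (simp add: m_def)
  have m_cont: "continuous_on UNIV m"
    unfolding m_def
    by (intro continuous_on_min continuous_at_imp_continuous_on ballI
        DERIV_isCont[OF ramp_derivatives(1)] DERIV_isCont[OF has_derivative_exp_shift(1)])
  have bound: "\<bar>u t x - \<phi> (x + c * t)\<bar> \<le> \<rho> / 2 * exp (- \<gamma> * t) * m (x + c * t)" if "t \<ge> 0" for t x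
  proof (rule stability_by_supersolution[OF h wave sol m_cont m0 _ _ _ that])
    show "\<bar>u 0 x - \<phi> x\<bar> \<le> \<rho> / 2 * m x" for x
    proof -
      have "\<bar>u 0 x - \<phi> x\<bar> \<le> \<rho> / 2 * (1 - \<epsilon>)" using hist[of 0 x] h by simp
      moreover have "\<rho> / 2 * (1 - \<epsilon>) \<le> \<rho> / 2 * ramp \<epsilon> c (x - b)"
        using ramp_bounds(1)[of \<epsilon>] \<epsilon> \<rho> by (intro mult_left_mono) auto
      moreover have "\<bar>u 0 x - \<phi> x\<bar> \<le> \<rho> / 2 * exp (l * (x - b))"
      proof (cases "x \<le> b")
        case True
        then show ?thesis using hist_far[of x 0] h by simp
      next
        case False
        have "exp (l * (x - b)) \<ge> 1" using False l by simp
        then have "1 - \<epsilon> \<le> exp (l * (x - b))" using \<epsilon>(1) by linarith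
        then have "\<rho> / 2 * (1 - \<epsilon>) \<le> \<rho> / 2 * exp (l * (x - b))"
          using \<rho> by (intro mult_left_mono) auto
        then show ?thesis using \<open>\<bar>u 0 x - \<phi> x\<bar> \<le> \<rho> / 2 * (1 - \<epsilon>)\<close> by linarith
      qed
      ultimately show ?thesis by (simp add: m_def min_def)
    qed
    fix t x :: real
    assume t: "0 < t" and past: "h \<le> t \<Longrightarrow> \<bar>u (t - h) x - \<phi> (x + c * (t - h))\<bar>
          \<le> \<rho> / 2 * exp (- \<gamma> * (t - h)) * m (x + c * (t - h))"
    define y where "y = x + c * t - b"
    define D where "D = \<bar>u (t - h) x - \<phi> (x + c * (t - h))\<bar>"
    define e where "e = exp (- \<gamma> * (t - h))"
    have arg: "x + c * (t - h) - b = y - c * h" by (simp add: y_def algebra_simps)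
    have e_old: "e \<ge> 1" if "\<not> h \<le> t" using \<gamma> that by (simp add: e_def mult_nonneg_nonpos)
    have e_new: "e \<le> 1" if "h \<le> t" using \<gamma> that by (simp add: e_def)
    have e0: "e > 0" by (simp add: e_def)
    have s: "t - h \<in> {-h..0}" if "\<not> h \<le> t" using t that by simp
    \<comment> \<open>For \<open>t < h\<close> the factor \<open>e\<close> exceeds \<open>1\<close>, so the bounds on the initial data imply the bounds with
        \<open>e\<close>, but \<open>D \<le> \<rho> / 2\<close> has to be read off from the data themselves.\<close>
    have D_exp: "D \<le> \<rho> / 2 * e * exp (l * (y - c * h))" if "y \<le> 0"
    proof (cases "h \<le> t")
      case True
      have "D \<le> \<rho> / 2 * e * m (x + c * (t - h))" using past[OF True] by (simp add: D_def e_def)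
      also have "\<dots> \<le> \<rho> / 2 * e * exp (l * (y - c * h))"
        using \<rho> e0 by (intro mult_left_mono) (auto simp: m_def arg)
      finally show ?thesis .
    next
      case False
      have "c * t > 0" using c t by simp
      then have "x \<le> b" using that by (simp add: y_def)
      then have "D \<le> \<rho> / 2 * 1 * exp (l * (y - c * h))"
        using hist_far[OF _ s[OF False], of x] by (simp add: D_def arg)
      also have "\<dots> \<le> \<rho> / 2 * e * exp (l * (y - c * h))"
        using \<rho> e_old[OF False] by (intro mult_right_mono mult_left_mono) auto
      finally show ?thesis .
    qed
    have D_ramp: "D \<le> \<rho> / 2 * e * ramp \<epsilon> c (y - c * h)" and D_small: "D \<le> \<rho> / 2"
    proof -
      have R: "1 - \<epsilon> \<le> ramp \<epsilon> c (y - c * h)" "ramp \<epsilon> c (y - c * h) \<le> 1"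
        using ramp_bounds[of \<epsilon> c "y - c * h"] \<epsilon> by auto
      have "D \<le> \<rho> / 2 * e * ramp \<epsilon> c (y - c * h) \<and> D \<le> \<rho> / 2"
      proof (cases "h \<le> t")
        case True
        have "D \<le> \<rho> / 2 * e * m (x + c * (t - h))" using past[OF True] by (simp add: D_def e_def)
        also have "\<dots> \<le> \<rho> / 2 * e * ramp \<epsilon> c (y - c * h)"
          using \<rho> e0 by (intro mult_left_mono) (auto simp: m_def arg)
        finally have 1: "D \<le> \<rho> / 2 * e * ramp \<epsilon> c (y - c * h)" .
        also have "\<dots> \<le> \<rho> / 2 * 1 * 1"
          using \<rho> e_new[OF True] e0 R \<epsilon> by (intro mult_mono) auto
        finally show ?thesis using 1 by simp
      next
        case False
        have D: "D \<le> \<rho> / 2 * (1 - \<epsilon>)" using hist[OF s[OF False], of x] by (simp add: D_def)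
        also have "\<rho> / 2 * (1 - \<epsilon>) = \<rho> / 2 * 1 * (1 - \<epsilon>)" by simp
        also have "\<dots> \<le> \<rho> / 2 * e * ramp \<epsilon> c (y - c * h)"
          using \<rho> e_old[OF False] R \<epsilon> by (intro mult_mono) auto
        finally have 1: "D \<le> \<rho> / 2 * e * ramp \<epsilon> c (y - c * h)" .
        have "\<rho> / 2 * (1 - \<epsilon>) \<le> \<rho> / 2 * 1" using \<rho> \<epsilon> by (intro mult_left_mono) auto
        then show ?thesis using D 1 by simp
      qed
      then show "D \<le> \<rho> / 2 * e * ramp \<epsilon> c (y - c * h)" "D \<le> \<rho> / 2" by auto
    qed
    let ?G = "\<bar>g (u (t - h) x) - g (\<phi> (x + c * (t - h)))\<bar>"
    show "\<exists>a b. superjet m (x + c * t) a b \<and>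
         ?G \<le> \<rho> / 2 * exp (- \<gamma> * t) * (c * a - b + (1 - \<gamma>) * m (x + c * t))"
    proof (cases "exp (l * y) \<le> ramp \<epsilon> c y")
      case True
      have "y \<le> 0"
      proof (rule ccontr)
        assume "\<not> ?thesis"
        then have "exp (l * y) > 1" using l by simp
        moreover have "ramp \<epsilon> c y \<le> 1" using ramp_bounds(2) \<epsilon> by simp
        ultimately show False using True by linarith
      qed
      have mz: "m (x + c * t) = exp (l * y)" using True by (simp add: m_def y_def)
      have "superjet m (x + c * t) (l * exp (l * y)) (l * (l * exp (l * y)))"
        unfolding y_def
        by (rule superjet_of_majorant[where p = "\<lambda>z. exp (l * (z - b))"])
           (use mz has_derivative_exp_shift in \<open>auto simp: m_def y_def\<close>)
      moreover have "?G \<le> deriv g 0 * D" using lipschitz_on_line[OF H] by (simp add: D_def)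
      then have "?G \<le> \<rho> / 2 * exp (- \<gamma> * t) *
          (c * (l * exp (l * y)) - l * (l * exp (l * y)) + (1 - \<gamma>) * exp (l * y))"
        by (rule order_trans, intro exponential_residual[OF rate_exp])
           (use D_exp[OF \<open>y \<le> 0\<close>] \<rho> L in \<open>auto simp: e_def\<close>)
      ultimately show ?thesis unfolding mz by blast
    next
      case False
      have "exp (- (l * (c * h))) < exp (l * y)"
        using False ramp_bounds(1)[of \<epsilon> c y] \<epsilon>(1,4) by linarith
      then have "l * (- (c * h)) < l * y" by simp
      then have y: "y \<ge> - (c * h)" using l by (simp only: mult_less_cancel_left_pos less_imp_le)
      have mz: "m (x + c * t) = ramp \<epsilon> c y" using False by (simp add: m_def y_def)
      have jet: "superjet m (x + c * t) (ramp' \<epsilon> c y) (ramp'' \<epsilon> c y)"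
        unfolding y_def
        by (rule superjet_of_majorant[where p = "\<lambda>z. ramp \<epsilon> c (z - b)"])
           (use mz ramp_derivatives in \<open>auto simp: m_def y_def\<close>)
      have \<phi>1: "\<bar>\<phi> (x + c * (t - h)) - \<kappa>\<bar> \<le> \<rho> / 4"
        by (rule \<phi>_near) (use arg y in linarith)
      have u1: "\<bar>u (t - h) x - \<kappa>\<bar> \<le> \<rho>"
        using \<phi>1 D_small \<rho> unfolding D_def by linarith
      have "?G \<le> \<rho> / 2 * exp (- \<gamma> * t) *
          (c * ramp' \<epsilon> c y - ramp'' \<epsilon> c y + (1 - \<gamma>) * ramp \<epsilon> c y)"
      proof (cases "y \<le> Y")
        case True
        have "r \<le> c * ramp' \<epsilon> c y - ramp'' \<epsilon> c y"
          unfolding r_def by (rule ramp_dissipation_lower_bound) (use \<epsilon> c y True in auto)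
        moreover have "?G \<le> 1 * D"
          using nonexpansive_of_deriv_less[OF slope u1, of "\<phi> (x + c * (t - h))"] \<phi>1 \<rho> by (simp add: D_def)
        ultimately show ?thesis
          by (elim order_trans, intro ramp_residual[where h = h])
             (use \<epsilon> c h \<rho> \<gamma> rate_mid D_ramp in \<open>auto simp: e_def\<close>)
      next
        case False
        have "\<bar>\<phi> (x + c * (t - h)) - \<kappa>\<bar> \<le> d"
          by (rule less_imp_le, rule Z) (use arg False in \<open>simp add: Y_def\<close>)
        then have "?G \<le> q * D"
          using contr[OF _ u1, of "\<phi> (x + c * (t - h))"] by (simp add: D_def abs_minus_commute)
        then show ?thesis
          by (rule order_trans, intro ramp_residual[where h = h])
             (use \<epsilon> c h \<rho> \<gamma> rate_q q D_ramp ramp_dissipation_nonneg[of \<epsilon> c y] in \<open>auto simp: e_def\<close>)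
      qed
      with jet show ?thesis unfolding mz by blast
    qed
  qed (use \<rho> in simp)
  have "\<bar>u t x - \<phi> (x + c * t)\<bar>
      \<le> \<rho> / 2 * exp (- \<gamma> * t) * min (exp (l * (x + c * t - b))) 1" if "t \<ge> 0" for t x
  proof -
    have "m z \<le> min (exp (l * (z - b))) 1" for z
      using ramp_bounds(2)[of \<epsilon> c "z - b"] \<epsilon> unfolding m_def by linarith
    then have "\<rho> / 2 * exp (- \<gamma> * t) * m (x + c * t)
        \<le> \<rho> / 2 * exp (- \<gamma> * t) * min (exp (l * (x + c * t - b))) 1"
      using \<rho> by (intro mult_left_mono) auto
    with bound[OF that, of x] show ?thesis by linarith
  qed
  with \<gamma> show "\<exists>\<gamma>>0. \<forall>t\<ge>0. \<forall>x. \<bar>u t x - \<phi> (x + c * t)\<bar>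
           \<le> \<rho> / 2 * exp (- \<gamma> * t) * min (exp (l * (x + c * t - b))) 1" by blast
qed

theorem theorem3:
  fixes h \<kappa> c l :: real
    and g \<phi> :: "real \<Rightarrow> real"
    and w\<^sub>0 u :: "real \<Rightarrow> real \<Rightarrow> real"
  assumes "h > 0"
    and "hyp_UM g \<kappa>"
    and "initial_function h w\<^sub>0" and "IC1 h w\<^sub>0"
    and "c > c_sharp g h"
    and "lambda1 g h c < l" and "l < lambda2 g h c"
    and "semi_wavefront g h c \<phi>"
    and "is_solution g h w\<^sub>0 u"
  shows
    "((SUP s\<in>{-h..0}. wnorm l (\<lambda>x. \<phi> (x + c * s) - w\<^sub>0 s x)) < \<infinity> \<longrightarrow>
       (\<exists>C>0. \<exists>\<gamma>>0. \<forall>t\<ge>0.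
          (SUP x. ereal (\<bar>u t x - \<phi> (x + c * t)\<bar> / xi (x + c * t) l))
            \<le> ereal (C * exp (- \<gamma> * t)))) \<and>
     (\<forall>\<rho>>0. \<forall>b\<ge>0.
       (\<forall>v\<in>{\<kappa>-\<rho>..\<kappa>+\<rho>}. g differentiable (at v) \<and> \<bar>deriv g v\<bar> < 1) \<and>
       (\<forall>x s. x \<ge> b - c * h \<and> s \<in> {-h..0} \<longrightarrow>
          \<kappa> - \<rho> / 4 \<le> w\<^sub>0 s x \<and> w\<^sub>0 s x < \<kappa> + \<rho> / 4 \<and>
          \<kappa> - \<rho> / 4 \<le> \<phi> (x + c * s) \<and> \<phi> (x + c * s) < \<kappa> + \<rho> / 4) \<and>
       (\<forall>x s. x \<le> b \<and> s \<in> {-h..0} \<longrightarrow>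
          \<bar>w\<^sub>0 s x - \<phi> (x + c * s)\<bar> \<le> 0.5 * \<rho> * exp (l * (x + c * s - b))) \<longrightarrow>
       wavefront g h \<kappa> c \<phi> \<and>
       (\<exists>\<gamma>>0. \<forall>t\<ge>0.
          (SUP x. ereal (\<bar>u t x - \<phi> (x + c * t)\<bar> / eta l (x + c * t)))
            \<le> ereal (0.5 * \<rho> * exp (- \<gamma> * t))))"
proof -
  have H: "hyp_H g \<kappa> (deriv g 0)" using assms(2) by (simp add: hyp_UM_def)
  then have L: "deriv g 0 > 1" by (simp add: hyp_H_def)
  have c: "c > 0" using supercritical_speed[OF L assms(1,5)] by simp
  have l: "l > 0" "chi0 g h c l < 0" using chi0_neg_between_lambda[OF L assms(1,5,6,7)] by auto
  show ?thesis
  proof (intro conjI impI allI; (elim conjE)?)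
    assume "(SUP s\<in>{-h..0}. wnorm l (\<lambda>x. \<phi> (x + c * s) - w\<^sub>0 s x)) < \<infinity>"
    from global_stability_exponential_weight[OF assms(1) H c l assms(8,9) this]
    obtain C \<gamma> where C: "C > 0" "\<gamma> > 0" "\<And>t x. t \<ge> 0 \<Longrightarrow>
        \<bar>u t x - \<phi> (x + c * t)\<bar> \<le> C * exp (- \<gamma> * t) * exp (l * (x + c * t))" by blast
    then have "(SUP x. ereal (\<bar>u t x - \<phi> (x + c * t)\<bar> / xi (x + c * t) l)) \<le> ereal (C * exp (- \<gamma> * t))"
      if "t \<ge> 0" for t
      using that by (intro SUP_least) (simp add: xi_def pos_divide_le_eq)
    with C show "\<exists>C>0. \<exists>\<gamma>>0. \<forall>t\<ge>0.
          (SUP x. ereal (\<bar>u t x - \<phi> (x + c * t)\<bar> / xi (x + c * t) l)) \<le> ereal (C * exp (- \<gamma> * t))"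
      by blast
  next
    fix \<rho> b :: real
    assume \<rho>: "\<rho> > 0" and b: "b \<ge> 0"
      and slope: "\<forall>v\<in>{\<kappa>-\<rho>..\<kappa>+\<rho>}. g differentiable (at v) \<and> \<bar>deriv g v\<bar> < 1"
      and near: "\<forall>x s. x \<ge> b - c * h \<and> s \<in> {-h..0} \<longrightarrow>
          \<kappa> - \<rho> / 4 \<le> w\<^sub>0 s x \<and> w\<^sub>0 s x < \<kappa> + \<rho> / 4 \<and>
          \<kappa> - \<rho> / 4 \<le> \<phi> (x + c * s) \<and> \<phi> (x + c * s) < \<kappa> + \<rho> / 4"
      and far: "\<forall>x s. x \<le> b \<and> s \<in> {-h..0} \<longrightarrow>
          \<bar>w\<^sub>0 s x - \<phi> (x + c * s)\<bar> \<le> 0.5 * \<rho> * exp (l * (x + c * s - b))"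
    have far': "\<bar>w\<^sub>0 s x - \<phi> (x + c * s)\<bar> \<le> \<rho> / 2 * exp (l * (x + c * s - b))"
      if "x \<le> b" "s \<in> {-h..0}" for x s
      using far that by simp
    note local = local_stability[OF assms(1) H c l assms(8,9,3) \<rho> slope near[rule_format, OF conjI] far']
    show "wavefront g h \<kappa> c \<phi>" using local(1) assms(8) by (simp add: wavefront_def)
    obtain \<gamma> where \<gamma>: "\<gamma> > 0" "\<And>t x. t \<ge> 0 \<Longrightarrow> \<bar>u t x - \<phi> (x + c * t)\<bar>
        \<le> \<rho> / 2 * exp (- \<gamma> * t) * min (exp (l * (x + c * t - b))) 1"
      using local(2) by blast
    have "(SUP x. ereal (\<bar>u t x - \<phi> (x + c * t)\<bar> / eta l (x + c * t))) \<le> ereal (0.5 * \<rho> * exp (- \<gamma> * t))"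
      if t: "t \<ge> 0" for t
    proof (rule SUP_least)
      fix x
      have "exp (l * (x + c * t - b)) \<le> exp (l * (x + c * t))" using l b by simp
      then have "min (exp (l * (x + c * t - b))) 1 \<le> eta l (x + c * t)"
        unfolding eta_def by linarith
      then have "\<rho> / 2 * exp (- \<gamma> * t) * min (exp (l * (x + c * t - b))) 1
          \<le> \<rho> / 2 * exp (- \<gamma> * t) * eta l (x + c * t)"
        using \<rho> by (intro mult_left_mono) auto
      with \<gamma>(2)[OF t, of x]
      have "\<bar>u t x - \<phi> (x + c * t)\<bar> \<le> 0.5 * \<rho> * exp (- \<gamma> * t) * eta l (x + c * t)" by simp
      moreover have "eta l (x + c * t) > 0" by (simp add: eta_def)
      ultimately show "ereal (\<bar>u t x - \<phi> (x + c * t)\<bar> / eta l (x + c * t))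
          \<le> ereal (0.5 * \<rho> * exp (- \<gamma> * t))"
        by (simp add: pos_divide_le_eq)
    qed
    with \<gamma>(1) show "\<exists>\<gamma>>0. \<forall>t\<ge>0.
          (SUP x. ereal (\<bar>u t x - \<phi> (x + c * t)\<bar> / eta l (x + c * t))) \<le> ereal (0.5 * \<rho> * exp (- \<gamma> * t))"
      by blast
  qed
qed

end
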